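(* For each dimension $n\ge1$ let $\mu=\mu_n$ be Lebesgue measure restricted to the unit ball of $\mathbb{R}^n$, $d\mu(x)=\chi_{B_1}(x)\,dx$. There exists a number $p_0>1$, with approximate value $p_0\approx 1.03946$, such that: (i) for every $p$ with $1\le p<p_0$ there exists an $\alpha>1$ (depending only on $p$) such that for every $n$, $$C_{\mu,p}\ \ge\ T_{\mu,p}(1,r)\ \ge\ \alpha^n$$ for some $0<r<\sqrt2-1$; (ii) for every $p>p_0$ and every choice of $0<r<R\le 1$ there exists an $\alpha<1$ (depending on $p,r,R$) such that for every $n$, $$T_{\mu,p}(R,r)\ \le\ \sqrt{\pi}\,n\,\alpha^n .$$
   Context: All balls are Euclidean: $B(x,R)$ is the ball in $\mathbb{R}^n$ of center $x$ and radius $R$, and $B_R=B(0,R)$. For a Borel measure $\mu$ on $\mathbb{R}^n$ and $g\in L^1_{loc}(\mathbb{R}^n)$ (with respect to $\mu$), the centered maximal function is $$M_\mu g(x)=\sup_{R>0}\frac{1}{\mu(B(x,R))}\int_{B(x,R)}|g(y)|\,d\mu(y)$$ (considered for $x$ in the support of $\mu$). $C_{\mu,p}\in[0,\infty]$ denotes the best (smallest) constant $C$ such that $\|M_\mu g\|_{L^p(\mu)}\le C\|g\|_{L^p(\mu)}$ for all $g\in L^p(\mu)$, with $C_{\mu,p}=\infty$ if there is no such finite constant. For radii $R>r>0$ and any unit vector $\xi\in\mathbb{R}^n$ (the choice is irrelevant by rotation invariance), write $\tilde B=B(R\xi,R+r)$ and $$T_{\mu,p}(R,r)=\frac{\mu(B_R)}{\mu(\tilde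 B)}\left(\frac{\mu(B_r)}{\mu(B_R)}\right)^{\frac{p-1}{p}} .$$ *)

theory Defs
  imports "HOL-Analysis.Analysis"
begin

text \<open>
  The dimension \<open>n\<close> is quantified inside the statement, below \<open>p\<close> and \<open>\<alpha>\<close>, so it cannot be a type.
  The space \<open>\<real>\<^sup>n\<close> is the carrier of the library's finite product measure over the index set
  \<open>{..<n}\<close>: functions \<open>nat \<Rightarrow> real\<close> that are \<open>undefined\<close> outside \<open>{..<n}\<close>.
  A Borel measure on \<open>\<real>\<^sup>n\<close> is a measure \<open>\<mu>\<close> with \<open>sets \<mu> = sets (Rn_lborel n)\<close>.
\<close>

abbreviation Rn :: "nat \<Rightarrow> (nat \<Rightarrow> real) set" where
  "Rn n \<equiv> {..<n} \<rightarrow>\<^sub>E (UNIV :: real set)"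

abbreviation Rn_lborel :: "nat \<Rightarrow> (nat \<Rightarrow> real) measure" where
  "Rn_lborel n \<equiv> Pi\<^sub>M {..<n} (\<lambda>_. lborel)"

definition Rn_zero :: "nat \<Rightarrow> nat \<Rightarrow> real" where
  "Rn_zero n = (\<lambda>i\<in>{..<n}. 0)"

definition Rn_scale :: "nat \<Rightarrow> real \<Rightarrow> (nat \<Rightarrow> real) \<Rightarrow> nat \<Rightarrow> real" where
  "Rn_scale n c x = (\<lambda>i\<in>{..<n}. c * x i)"

definition Rn_sphere :: "nat \<Rightarrow> (nat \<Rightarrow> real) set" where
  "Rn_sphere n = {x \<in> Rn n. L2_set x {..<n} = 1}"

definition Rn_ball :: "nat \<Rightarrow> (nat \<Rightarrow> real) \<Rightarrow> real \<Rightarrow> (nat \<Rightarrow> real) set" where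
  "Rn_ball n x R = {y \<in> Rn n. L2_set (\<lambda>i. y i - x i) {..<n} < R}"

text \<open>
  The value lies in \<open>[0,\<infinity>]\<close>. At points outside the support of \<open>\<mu>\<close>, which form a \<open>\<mu>\<close>-null set,
  balls of measure zero contribute \<open>0 / 0 = 0\<close> to the supremum.
\<close>

definition maximal_fun ::
    "nat \<Rightarrow> (nat \<Rightarrow> real) measure \<Rightarrow> ((nat \<Rightarrow> real) \<Rightarrow> real) \<Rightarrow> (nat \<Rightarrow> real) \<Rightarrow> ennreal" where
  "maximal_fun n \<mu> g x =
     (SUP R\<in>{0<..}. (\<integral>\<^sup>+y\<in>Rn_ball n x R. ennreal \<bar>g y\<bar> \<partial>\<mu>) / emeasure \<mu> (Rn_ball n x R))"

text \<open>Powers on \<open>[0,\<infinity>]\<close>; only used for exponents \<open>a > 0\<close>.\<close>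

definition ennreal_powr :: "ennreal \<Rightarrow> real \<Rightarrow> ennreal" where
  "ennreal_powr x a = (if x = \<infinity> then \<infinity> else ennreal (enn2real x powr a))"

definition Lp_norm :: "'a measure \<Rightarrow> real \<Rightarrow> ('a \<Rightarrow> ennreal) \<Rightarrow> ennreal" where
  "Lp_norm \<mu> p f = ennreal_powr (\<integral>\<^sup>+x. ennreal_powr (f x) p \<partial>\<mu>) (1 / p)"

definition Lp_space :: "'a measure \<Rightarrow> real \<Rightarrow> ('a \<Rightarrow> real) set" where
  "Lp_space \<mu> p = {g \<in> borel_measurable \<mu>. Lp_norm \<mu> p (\<lambda>x. ennreal \<bar>g x\<bar>) < \<infinity>}"

text \<open>The infimum of the empty set is \<open>\<infinity>\<close>, the value when no finite constant exists.\<close>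

definition best_const :: "nat \<Rightarrow> (nat \<Rightarrow> real) measure \<Rightarrow> real \<Rightarrow> ennreal" where
  "best_const n \<mu> p =
     Inf {ennreal C |C. 0 \<le> C \<and>
       (\<forall>g\<in>Lp_space \<mu> p.
          Lp_norm \<mu> p (maximal_fun n \<mu> g) \<le> ennreal C * Lp_norm \<mu> p (\<lambda>x. ennreal \<bar>g x\<bar>))}"

text \<open>
  The unit vector \<open>\<xi>\<close> is an explicit argument: independence of its choice for rotation invariant
  \<open>\<mu>\<close> is a fact to be proved, so statements should quantify over all \<open>\<xi> \<in> Rn_sphere n\<close>.
\<close>

definition test_quot ::
    "nat \<Rightarrow> (nat \<Rightarrow> real) measure \<Rightarrow> real \<Rightarrow> (nat \<Rightarrow> real) \<Rightarrow> real \<Rightarrow> real \<Rightarrow> real" where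
  "test_quot n \<mu> p \<xi> R r =
     measure \<mu> (Rn_ball n (Rn_zero n) R) / measure \<mu> (Rn_ball n (Rn_scale n R \<xi>) (R + r)) *
     (measure \<mu> (Rn_ball n (Rn_zero n) r) / measure \<mu> (Rn_ball n (Rn_zero n) R)) powr ((p - 1) / p)"

definition unit_ball_measure :: "nat \<Rightarrow> (nat \<Rightarrow> real) measure" where
  "unit_ball_measure n = density (Rn_lborel n) (indicator (Rn_ball n (Rn_zero n) 1))"

end

(* Write s = (p - 1) / p, and let h(r) be the radius of the equator of the lens B(0,1) \<inter> B(\<xi>,1+r). For
   r < sqrt 2 - 1 the lens lies in the ball with the same equator, and it contains the double cone over
   its equatorial disc with apexes \<xi> and -r\<xi>. So its volume is h(r)^n |B_1| up to a factor sqrt(pi) n,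
   and T(1,r) is (r^s / h(r))^n up to the same factor. The threshold for s is therefore
   s0 = sup ln h(r) / ln r, and p0 = 1 / (1 - s0). The case of general R follows from the inclusion of
   B(0,R) in the unit ball. The bound C >= T comes from the indicator of B(0,r): for every x in the unit
   ball, the lens at x of radius |x| + r is at most as large as the one at \<xi>, by rotation invariance,
   which holds because Householder reflections are compositions of shears and a sign change. *)
theory Submission
  imports Defs
begin

section \<open>The critical exponent\<close>

text \<open>A factor of order \<open>n\<close> does not change an exponential rate, so with
  \<open>s = (p - 1) / p\<close> both claims hang on the sign of
  \<open>s * ln r - ln (lens_radius r)\<close>: positive for some \<open>r\<close> if
  \<open>s < s0\<close>, negative for every \<open>r\<close> if \<open>s > s0\<close>. Placing
  \<open>p0\<close> within 5e-6 of 1.03946 is done by confining \<open>s0\<close> to the interval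
  from 0.03796 to 0.0379666. The lower end takes one value of \<open>r\<close>. The upper end is an
  inequality for all \<open>r\<close> whose slack is only about 4.4e-6 at the worst
  \<open>r\<close>; crude interval bounds are useless there, and convexity takes their place. Since
  \<open>n\<close> is quantified below \<alpha>, the space is a set of functions with a product
  measure. Translation and reflection invariance and the volume of a cone are obtained from boxes,
  Fubini and affine substitutions in one real variable.\<close>

text \<open>
  For a unit vector \<open>\<xi>\<close>, the boundary spheres of \<open>B(0, 1)\<close> and \<open>B(\<xi>, 1 + r)\<close> meet in a sphere of
  this radius; its centre is \<open>lens_height r\<close> times \<open>\<xi>\<close>, with \<open>lens_height\<close> defined below.
\<close>

definition lens_radius :: "real \<Rightarrow> real" where
  "lens_radius r = sqrt ((1 + r)^2 * (1 - r) * (3 + r) / 4)"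

section \<open>Numerical bounds for logarithms\<close>

lemma ln2_lower: "ln (2::real) \<ge> 0.69314" and ln2_upper: "ln (2::real) \<le> 0.69316"
  using ln_approx_bounds[of 2 5] by (simp_all add: eval_nat_numeral)

text \<open>Since \<open>ln x = 2 * artanh y\<close>, two terms of the odd power series bound it
  from below, and a geometric majorant of the tail bounds it from above. The bounds are sharp for
  \<open>x\<close> near 1.\<close>

lemma
  fixes x :: real
  assumes "x > 1"
  defines "y \<equiv> (x - 1) / (x + 1)"
  shows ln_lower: "ln x \<ge> 2 * y + 2 * y^3 / 3"
    and ln_upper: "ln x \<le> 2 * y + 2 * y^3 / 3 + 2 * y^5 / (5 * (1 - y^2))"
proof -
  have "ln x \<in> {(\<Sum>k<2. 2*y^(2*k+1) / of_nat (2*k+1))..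
      (\<Sum>k<2. 2*y^(2*k+1) / of_nat (2*k+1)) + 2 * (y^(2*2+1) / (1 - y^2) / of_nat (2*2+1))}"
    unfolding y_def by (rule ln_approx_bounds[OF assms(1)])
  then show "ln x \<ge> 2 * y + 2 * y^3 / 3"
    "ln x \<le> 2 * y + 2 * y^3 / 3 + 2 * y^5 / (5 * (1 - y^2))"
    by (simp_all add: eval_nat_numeral mult.commute)
qed

text \<open>An exponent \<open>s0 \<le> 0.0379666\<close> gives \<open>1 / (1 - s0) < 1.039465\<close>.\<close>

definition crit_gap :: "real \<Rightarrow> real" where
  "crit_gap r = ln (1 + r) + ln (1 - r) / 2 + ln (3 + r) / 2 - ln 2 - 0.0379666 * ln r"

text \<open>The lens radius is at most 1, while \<open>ln_lower\<close> and \<open>ln_upper\<close>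
  want arguments above 1; hence the reciprocal.\<close>

lemma ln_lens_radius_inverse:
  assumes "0 < r" "r < 1"
  shows "ln (lens_radius r) = - ln (4 / ((1 + r)^2 * (1 - r) * (3 + r))) / 2"
proof -
  have pos: "0 < (1 + r)^2 * (1 - r) * (3 + r)" using assms by simp
  then have "ln (lens_radius r) = ln ((1 + r)^2 * (1 - r) * (3 + r) / 4) / 2"
    unfolding lens_radius_def by (subst ln_sqrt) auto
  moreover have "ln (4 / ((1 + r)^2 * (1 - r) * (3 + r))) = - ln ((1 + r)^2 * (1 - r) * (3 + r) / 4)"
    using pos by (subst ln_inverse[symmetric]) (simp_all add: field_simps)
  ultimately show ?thesis by simp
qed

lemma ln_lens_radius:
  assumes "0 < r" "r < 1"
  shows "ln (lens_radius r) = ln (1 + r) + ln (1 - r) / 2 + ln (3 + r) / 2 - ln 2"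
proof -
  have "ln (4 / ((1 + r)^2 * (1 - r) * (3 + r))) = ln (2^2) - (2 * ln (1 + r) + ln (1 - r) + ln (3 + r))"
    using assms by (simp add: ln_div ln_mult ln_realpow)
  also have "ln (2^2) = 2 * ln (2::real)" using ln_realpow[of "2::real" 2] by simp
  finally show ?thesis using assms by (simp add: ln_lens_radius_inverse)
qed

lemma crit_gap_eq:
  assumes "0 < r" "r < 1"
  shows "crit_gap r = ln (lens_radius r) - 0.0379666 * ln r"
  using assms by (simp add: crit_gap_def ln_lens_radius)

text \<open>
  On \<open>0 < r < sqrt 2 - 1\<close> the gap is minimal near \<open>r = 0.06734\<close>, with a value of about \<open>4.4e-6\<close>. It is
  convex for \<open>r \<le> 0.14\<close>, so there the tangent at \<open>0.06734\<close> bounds it from below.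
\<close>

lemma crit_gap_near_minimum: "crit_gap 0.06734 \<ge> 0.000002"
proof -
  let ?r = "0.06734 :: real"
  have a: "ln (4 / ((1 + ?r)^2 * (1 - ?r) * (3 + ?r))) \<le> 0.20486"
    by (rule order_trans[OF ln_upper]) (simp_all add: eval_nat_numeral)
  \<comment> \<open>The factor 16 moves the argument to about 1.077, where the series converges
    fast.\<close>
  have "ln (16 * ?r) \<le> 0.0746"
    by (rule order_trans[OF ln_upper]) (simp_all add: eval_nat_numeral)
  moreover have "ln (16::real) = 4 * ln 2" using ln_realpow[of "2::real" 4] by simp
  moreover have "ln (16 * ?r) = ln 16 + ln ?r" by (rule ln_mult_pos) simp_all
  ultimately have "ln ?r \<le> 0.0746 - 4 * 0.69314" using ln2_lower by linarith
  then show ?thesis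
    using a by (simp add: crit_gap_eq ln_lens_radius_inverse)
qed

lemma crit_gap_pos_convex_part:
  assumes "0 < r" "r \<le> 0.14"
  shows "crit_gap r > 0"
proof -
  define q where "q c d r = 1 / (c + d * r)" for c d r :: real
  define f' where "f' r = q 1 1 r - q 1 (- 1) r / 2 + q 3 1 r / 2 - 0.0379666 * q 0 1 r" for r
  define f'' where "f'' r = - (1 / (1 + r)^2) - 1 / (1 - r)^2 / 2 - 1 / (3 + r)^2 / 2 + 0.0379666 * (1 / r^2)"
    for r :: real
  have q: "(q c d has_real_derivative - d * (1 / (c + d * x)^2)) (at x)" if "c + d * x \<noteq> 0" for c d x
    unfolding q_def using that by (auto intro!: derivative_eq_intros simp: power2_eq_square)
  have ln: "((\<lambda>x. ln (c + d * x)) has_real_derivative d * q c d x) (at x)" if "c + d * x > 0" for c d x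
    unfolding q_def using that by (auto intro!: derivative_eq_intros)
  have gap: "crit_gap = (\<lambda>r. ln (1 + 1 * r) + ln (1 + (- 1) * r) / 2 + ln (3 + 1 * r) / 2 - ln 2
      - 0.0379666 * ln (0 + 1 * r))"
    by (simp add: fun_eq_iff crit_gap_def)
  have "f' 0.06734 * (r - 0.06734) \<le> crit_gap r - crit_gap 0.06734"
  proof (rule f''_imp_f'[where C = "{0<..0.14}" and f'' = f''])
    fix x :: real assume x: "x \<in> {0<..0.14}"
    have "DERIV crit_gap x :> 1 * q 1 1 x + (- 1) * q 1 (- 1) x / 2 + 1 * q 3 1 x / 2 - 0 - 0.0379666 * (1 * q 0 1 x)"
      unfolding gap using x
      by (intro DERIV_diff DERIV_add DERIV_cdivide DERIV_cmult ln DERIV_const) auto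
    then show "DERIV crit_gap x :> f' x" by (simp add: f'_def)
    have "DERIV f' x :> - 1 * (1 / (1 + 1 * x)^2) - - (- 1) * (1 / (1 + (- 1) * x)^2) / 2
       + - 1 * (1 / (3 + 1 * x)^2) / 2 - 0.0379666 * (- 1 * (1 / (0 + 1 * x)^2))"
      unfolding f'_def using x by (intro DERIV_diff DERIV_add DERIV_cdivide DERIV_cmult q) auto
    then show "DERIV f' x :> f'' x" by (simp add: f''_def)
    \<comment> \<open>The three negative terms of \<open>f''\<close> total at most 1.733 in absolute
      value, while the positive one is at least \<open>0.0379666 * 51 > 1.93\<close>. This is what
      limits convexity to about 0.14.\<close>
    have "1 / (1 + x)^2 \<le> 1" using x one_le_power[of "1 + x" 2] by (simp add: divide_le_eq_1)
    moreover have "1 / (1 - x)^2 \<le> 1 / 0.86^2" "1 / (3 + x)^2 \<le> 1 / 3^2" "1 / x^2 \<ge> 1 / 0.14^2"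
      using x by (intro divide_left_mono power_mono; auto)+
    moreover have "1 / 0.86^2 \<le> (1.3521::real)" "1 / 3^2 \<le> (0.112::real)" "1 / 0.14^2 \<ge> (51::real)"
      by (simp_all add: power2_eq_square)
    ultimately have "1 / (1 + x)^2 \<le> 1" "1 / (1 - x)^2 \<le> 1.3521" "1 / (3 + x)^2 \<le> 0.112" "1 / x^2 \<ge> 51"
      by linarith+
    moreover have "0 \<le> - a - b / 2 - c / 2 + 0.0379666 * d"
      if "a \<le> 1" "b \<le> 1.3521" "c \<le> 0.112" "51 \<le> d" for a b c d :: real
      using that by simp
    ultimately show "f'' x \<ge> 0" unfolding f''_def by blast
  qed (use assms in \<open>auto simp: convex_real_interval\<close>)
  \<comment> \<open>The tangent is nearly flat and rises to the right. Towards 0 it loses at most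
    \<open>0.00002 * 0.06734\<close>, about 1.35e-6, out of the 2e-6 available at 0.06734.\<close>
  moreover have "f' 0.06734 \<ge> 0" "f' 0.06734 \<le> 0.00002"
    unfolding f'_def q_def by simp_all
  moreover from this have "f' 0.06734 * (r - 0.06734) \<ge> f' 0.06734 * (- 0.06734)"
    using assms by (intro mult_left_mono) auto
  moreover have "f' 0.06734 * (- 0.06734) \<ge> 0.00002 * (- 0.06734)"
    using \<open>f' 0.06734 \<le> 0.00002\<close> by (intro mult_right_mono_neg) auto
  ultimately have "crit_gap r \<ge> 0.000002 - 0.00002 * 0.06734" using crit_gap_near_minimum by linarith
  then show ?thesis by simp
qed

text \<open>With \<open>S = (1 + r)^2\<close> the squared radius is \<open>S * (4 - S) / 4\<close>,
  which increases up to \<open>S = 2\<close>, that is, up to \<open>r = sqrt 2 - 1\<close>.\<close>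

lemma lens_radius_mono:
  assumes "0 \<le> a" "a \<le> b" "b \<le> sqrt 2 - 1"
  shows "lens_radius a \<le> lens_radius b"
proof -
  have "(1 + b)^2 \<le> (sqrt 2)^2" using assms by (intro power_mono) auto
  then have "(1 + b)^2 \<le> 2" by simp
  moreover have "(1 + a)^2 \<le> (1 + b)^2" using assms by (intro power_mono) auto
  ultimately have "0 \<le> ((1 + b)^2 - (1 + a)^2) * (4 - (1 + b)^2 - (1 + a)^2)" by simp
  then have "(1 + a)^2 * (4 - (1 + a)^2) \<le> (1 + b)^2 * (4 - (1 + b)^2)"
    by (simp add: algebra_simps)
  moreover have eq: "(1 + x)^2 * (1 - x) * (3 + x) = (1 + x)^2 * (4 - (1 + x)^2)" for x :: real
    by (simp add: power2_eq_square algebra_simps)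
  ultimately show ?thesis unfolding lens_radius_def eq
    by (intro real_sqrt_le_mono divide_right_mono) auto
qed

text \<open>Both logarithms in the gap increase with \<open>r\<close>, so on the interval from
  \<open>a\<close> to \<open>b\<close> the gap is at least
  \<open>ln (lens_radius a) - 0.0379666 * ln b\<close>. One numerical check settles a whole
  interval.\<close>

lemma crit_gap_pos_between:
  fixes a b :: real
  assumes ab: "0 < a" "a \<le> r" "r \<le> b" "b < 1" "r < sqrt 2 - 1"
    and num: "ln (4 / ((1 + a)^2 * (1 - a) * (3 + a))) \<le> u" "ln b \<le> - v" "u / 2 < 0.0379666 * v"
  shows "crit_gap r > 0"
proof -
  have "ln (lens_radius a) \<le> ln (lens_radius r)"
    using lens_radius_mono[of a r] ab by (auto simp: lens_radius_def)
  moreover have "ln r \<le> ln b" using ab by simp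
  moreover have "ln (lens_radius a) = - ln (4 / ((1 + a)^2 * (1 - a) * (3 + a))) / 2"
    using ab by (intro ln_lens_radius_inverse) auto
  moreover have "crit_gap r = ln (lens_radius r) - 0.0379666 * ln r"
    using ab by (intro crit_gap_eq) auto
  ultimately show ?thesis using num by simp
qed

lemma crit_gap_pos:
  assumes "0 < r" "r < sqrt 2 - 1"
  shows "crit_gap r > 0"
proof -
  have "sqrt 2 < (1.4143::real)" by (rule real_less_lsqrt) (simp_all add: power2_eq_square)
  \<comment> \<open>Doubling \<open>k\<close> times brings \<open>x\<close> close to 1, where the
    bounds on \<open>ln\<close> are good.\<close>
  have ln_shift: "ln x \<le> - (k * 0.69314) + ln (2^k * x)" if "x > 0" for k :: nat and x :: real
    using that mult_left_mono[OF ln2_lower, of "real k"] by (simp add: ln_mult ln_realpow)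
  have bound: "r \<le> 0.4143" using assms \<open>sqrt 2 < 1.4143\<close> by simp
  \<comment> \<open>Beyond 0.14 the gap is large enough for three coarse intervals.\<close>
  consider "r \<le> 0.14" | "0.14 \<le> r" "r \<le> 0.17" | "0.17 \<le> r" "r \<le> 0.24" | "0.24 \<le> r" "r \<le> 0.4143"
    using bound by (meson linear)
  then show ?thesis
  proof cases
    case 1
    then show ?thesis using assms crit_gap_pos_convex_part by simp
  next
    case 2
    have "ln (2^3 * 0.17::real) \<le> 0.3076"
      by (rule order_trans[OF ln_upper]) (simp_all add: eval_nat_numeral)
    then have "ln (0.17::real) \<le> - 1.77" using ln_shift[of "0.17" 3] by simp
    moreover have "ln (4 / ((1 + 0.14)^2 * (1 - 0.14) * (3 + 0.14))) \<le> (0.131::real)"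
      by (rule order_trans[OF ln_upper]) (simp_all add: eval_nat_numeral)
    ultimately show ?thesis using 2 assms by (intro crit_gap_pos_between[of "0.14" r "0.17"]) auto
  next
    case 3
    have "ln (2^2 * 0.24::real) \<le> - 0.04"
      by (rule order_trans[OF ln_le_minus_one]) simp_all
    then have "ln (0.24::real) \<le> - 1.42" using ln_shift[of "0.24" 2] by simp
    moreover have "ln (4 / ((1 + 0.17)^2 * (1 - 0.17) * (3 + 0.17))) \<le> (0.105::real)"
      by (rule order_trans[OF ln_upper]) (simp_all add: eval_nat_numeral)
    ultimately show ?thesis using 3 assms by (intro crit_gap_pos_between[of "0.17" r "0.24"]) auto
  next
    case 4
    have "ln (2 * 0.4143::real) \<le> - 0.17"
      by (rule order_trans[OF ln_le_minus_one]) simp_all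
    then have "ln (0.4143::real) \<le> - 0.86" using ln_shift[of "0.4143" 1] by simp
    moreover have "ln (4 / ((1 + 0.24)^2 * (1 - 0.24) * (3 + 0.24))) \<le> (0.057::real)"
      by (rule order_trans[OF ln_le_minus_one]) (simp_all add: eval_nat_numeral)
    ultimately show ?thesis using 4 assms by (intro crit_gap_pos_between[of "0.24" r "0.4143"]) auto
  qed
qed

text \<open>The exponent \<open>s\<close> that solves
  \<open>r powr s = lens_radius r\<close>.\<close>

definition crit_exponent :: "real \<Rightarrow> real" where
  "crit_exponent r = ln (lens_radius r) / ln r"

lemma crit_exponent_upper:
  assumes "0 < r" "r < sqrt 2 - 1"
  shows "crit_exponent r \<le> 0.0379666"
proof -
  have "r < 1" using assms sqrt2_less_2 by simp
  then show ?thesis using crit_gap_pos[OF assms] assms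
    by (simp add: crit_gap_eq crit_exponent_def field_simps)
qed

text \<open>The point 0.0673 is close to the maximiser, and \<open>1 / (1 - 0.03796)\<close> exceeds
  1.039457, inside the tolerance for \<open>p0\<close>.\<close>

lemma crit_exponent_lower: "crit_exponent 0.0673 \<ge> 0.03796"
proof -
  have "ln (4 / ((1 + 0.0673)^2 * (1 - 0.0673) * (3 + 0.0673))) \<ge> (0.20489::real)"
    by (rule order_trans[OF _ ln_lower]) (simp_all add: eval_nat_numeral)
  moreover have "ln (16 * 0.0673::real) \<ge> 0.0739"
    by (rule order_trans[OF _ ln_lower]) (simp_all add: eval_nat_numeral)
  moreover have "ln (16::real) = 4 * ln 2" using ln_realpow[of "2::real" 4] by simp
  moreover have "ln (16 * 0.0673::real) = ln 16 + ln 0.0673" by (rule ln_mult_pos) simp_all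
  moreover have "ln (0.0673::real) < 0" by simp
  ultimately show ?thesis using ln2_upper ln_lens_radius_inverse[of "0.0673"]
    unfolding crit_exponent_def by (simp add: field_simps)
qed

section \<open>Volumes in \<open>\<real>\<^sup>n\<close>\<close>

lemma L2_set_less_iff:
  assumes "0 < R"
  shows "L2_set f A < R \<longleftrightarrow> (\<Sum>i\<in>A. (f i)\<^sup>2) < R\<^sup>2"
  unfolding L2_set_def using assms
  by (metis less_eq_real_def real_sqrt_abs abs_of_nonneg real_sqrt_less_iff)

lemma Rn_ball_eq_Collect_space:
  "Rn_ball n c R = {y \<in> space (Rn_lborel n). L2_set (\<lambda>i. y i - c i) {..<n} < R}"
  by (simp add: Rn_ball_def space_PiM)

lemma Rn_ball_measurable [measurable]: "Rn_ball n c R \<in> sets (Rn_lborel n)"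
  unfolding Rn_ball_eq_Collect_space L2_set_def by measurable

lemma product_sigma_finite_lborel: "product_sigma_finite (\<lambda>_. lborel :: real measure)"
  by standard

lemma sigma_finite_PiM_lborel:
  "finite I \<Longrightarrow> sigma_finite_measure (PiM I (\<lambda>_. lborel :: real measure))"
  by (rule product_sigma_finite.sigma_finite[OF product_sigma_finite_lborel])

lemma distr_PiM_lborel_translate:
  fixes a :: "'i \<Rightarrow> real"
  assumes "finite I"
  shows "distr (PiM I (\<lambda>_. lborel)) (PiM I (\<lambda>_. lborel)) (\<lambda>x. \<lambda>i\<in>I. x i + a i) = PiM I (\<lambda>_. lborel)"
proof -
  interpret product_sigma_finite "\<lambda>_::'i. lborel :: real measure" by standard
  show ?thesis
  proof (rule PiM_eqI)
    fix A :: "'i \<Rightarrow> real set" assume A: "\<And>i. i \<in> I \<Longrightarrow> A i \<in> sets lborel"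
    have "emeasure (distr (PiM I (\<lambda>_. lborel)) (PiM I (\<lambda>_. lborel)) (\<lambda>x. \<lambda>i\<in>I. x i + a i)) (Pi\<^sub>E I A)
        = emeasure (PiM I (\<lambda>_. lborel)) (Pi\<^sub>E I (\<lambda>i. (\<lambda>x. a i + x) -` A i))"
      using A assms
      by (subst emeasure_distr)
         (auto intro!: arg_cong2[where f = emeasure] sets_PiM_I_finite simp: space_PiM PiE_iff add.commute)
    also have "\<dots> = (\<Prod>i\<in>I. emeasure lborel ((\<lambda>x. a i + x) -` A i))"
      proof (rule emeasure_PiM[OF assms])
      fix i assume "i \<in> I"
      have "(+) (a i) \<in> borel_measurable borel" by simp
      from measurable_sets_borel[OF this] A[OF \<open>i \<in> I\<close>]
      show "(+) (a i) -` A i \<in> sets lborel" by simp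
    qed
    also have "\<dots> = (\<Prod>i\<in>I. emeasure lborel (A i))"
    proof (rule prod.cong[OF refl])
      fix i assume "i \<in> I"
      have "emeasure lborel (A i) = emeasure (distr lborel borel (\<lambda>x. a i + x)) (A i)"
        by (simp add: lborel_distr_plus)
      also have "\<dots> = emeasure lborel ((\<lambda>x. a i + x) -` A i)"
        using A[OF \<open>i \<in> I\<close>] by (subst emeasure_distr) auto
      finally show "emeasure lborel ((\<lambda>x. a i + x) -` A i) = emeasure lborel (A i)" by simp
    qed
    finally show "emeasure (distr (PiM I (\<lambda>_. lborel)) (PiM I (\<lambda>_. lborel)) (\<lambda>x. \<lambda>i\<in>I. x i + a i)) (Pi\<^sub>E I A)
        = (\<Prod>i\<in>I. emeasure lborel (A i))" .
  qed (use assms in simp_all)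
qed

lemma nn_integral_PiM_lborel_translate:
  fixes a :: "'i \<Rightarrow> real"
  assumes "finite I" and [measurable]: "f \<in> borel_measurable (PiM I (\<lambda>_. lborel))"
  shows "(\<integral>\<^sup>+x. f (\<lambda>i\<in>I. x i + a i) \<partial>PiM I (\<lambda>_. lborel)) = integral\<^sup>N (PiM I (\<lambda>_. lborel)) f"
proof -
  have "integral\<^sup>N (distr (PiM I (\<lambda>_. lborel)) (PiM I (\<lambda>_. lborel)) (\<lambda>x. \<lambda>i\<in>I. x i + a i)) f
      = (\<integral>\<^sup>+x. f (\<lambda>i\<in>I. x i + a i) \<partial>PiM I (\<lambda>_. lborel))"
    by (rule nn_integral_distr) measurable
  then show ?thesis by (simp add: distr_PiM_lborel_translate assms(1))
qed

text \<open>\<open>emeasure_cball_aux\<close> speaks of closed balls. The open ball lies in the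
  closed one and contains the closed balls of all radii \<open>s < R\<close>; let \<open>s\<close>
  tend to \<open>R\<close>.\<close>

lemma emeasure_Rn_ball_zero:
  assumes "0 < R"
  shows "emeasure (Rn_lborel n) (Rn_ball n (Rn_zero n) R) = ennreal (unit_ball_vol n * R ^ n)"
proof (rule antisym)
  define C where "C R = {f. sqrt (\<Sum>i<n. (f i)\<^sup>2) \<le> R} \<inter> space (Rn_lborel n)" for R
  have C [measurable]: "C R \<in> sets (Rn_lborel n)" for R
  proof -
    have "C R = {f \<in> space (Rn_lborel n). sqrt (\<Sum>i<n. (f i)\<^sup>2) \<le> R}" by (auto simp: C_def)
    then show ?thesis by simp
  qed
  have vol: "emeasure (Rn_lborel n) (C R) = ennreal (unit_ball_vol n * R ^ n)" if "R > 0" for R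
    using emeasure_cball_aux[of "{..<n}" R] that by (simp add: C_def)
  have eq: "Rn_ball n (Rn_zero n) R = {f \<in> space (Rn_lborel n). sqrt (\<Sum>i<n. (f i)\<^sup>2) < R}" for R
    unfolding Rn_ball_eq_Collect_space by (simp add: Rn_zero_def L2_set_def)
  show "emeasure (Rn_lborel n) (Rn_ball n (Rn_zero n) R) \<le> ennreal (unit_ball_vol n * R ^ n)"
    unfolding vol[OF assms, symmetric] by (intro emeasure_mono C) (auto simp: eq C_def)
  show "ennreal (unit_ball_vol n * R ^ n) \<le> emeasure (Rn_lborel n) (Rn_ball n (Rn_zero n) R)"
  proof (rule tendsto_upperbound)
    show "((\<lambda>s. ennreal (unit_ball_vol n * s ^ n)) \<longlongrightarrow> ennreal (unit_ball_vol n * R ^ n)) (at_left R)"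
      by (intro tendsto_ennrealI tendsto_intros)
    have "eventually (\<lambda>s. s \<in> {0<..<R}) (at_left R)"
      using assms by (intro eventually_at_leftI[of 0]) auto
    then show "eventually (\<lambda>s. ennreal (unit_ball_vol n * s ^ n) \<le> emeasure (Rn_lborel n) (Rn_ball n (Rn_zero n) R)) (at_left R)"
    proof eventually_elim
      case (elim s)
      then have "emeasure (Rn_lborel n) (C s) \<le> emeasure (Rn_lborel n) (Rn_ball n (Rn_zero n) R)"
        by (intro emeasure_mono Rn_ball_measurable) (auto simp: eq C_def)
      then show ?case using elim vol[of s] by simp
    qed
  qed simp
qed

lemma emeasure_Rn_ball:
  assumes "0 < R"
  shows "emeasure (Rn_lborel n) (Rn_ball n c R) = ennreal (unit_ball_vol n * R ^ n)"
proof -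
  have "emeasure (Rn_lborel n) (Rn_ball n c R) = (\<integral>\<^sup>+x. indicator (Rn_ball n c R) x \<partial>Rn_lborel n)"
    by simp
  also have "\<dots> = (\<integral>\<^sup>+x. indicator (Rn_ball n c R) (\<lambda>i\<in>{..<n}. x i + c i) \<partial>Rn_lborel n)"
    by (rule nn_integral_PiM_lborel_translate[symmetric]) auto
  also have "\<dots> = (\<integral>\<^sup>+x. indicator (Rn_ball n (Rn_zero n) R) x \<partial>Rn_lborel n)"
    by (intro nn_integral_cong)
       (auto simp: indicator_def Rn_ball_def Rn_zero_def space_PiM L2_set_def)
  finally show ?thesis using emeasure_Rn_ball_zero[OF assms] by simp
qed

text \<open>Fubini in the last coordinate: the slice at height \<open>y\<close> is an
  \<open>m\<close>-dimensional ball of radius \<open>F y\<close>. The indicator is essential,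
  because the slice is empty for \<open>F y \<le> 0\<close> although \<open>F y ^ m\<close> can be
  positive there, for instance when \<open>m = 0\<close>.\<close>

lemma emeasure_graph:
  fixes F :: "real \<Rightarrow> real"
  assumes [measurable]: "F \<in> borel_measurable borel"
  shows "emeasure (Rn_lborel (Suc m)) {x \<in> Rn (Suc m). L2_set x {..<m} < F (x m)} =
     (\<integral>\<^sup>+y. ennreal (unit_ball_vol m * F y ^ m) * indicator {y. F y > 0} y \<partial>lborel)"
proof -
  interpret product_sigma_finite "\<lambda>_::nat. lborel :: real measure" by standard
  let ?E = "{x \<in> space (Rn_lborel (Suc m)). L2_set x {..<m} < F (x m)}"
  have E [measurable]: "?E \<in> sets (Rn_lborel (Suc m))"
    unfolding L2_set_def by measurable
  have ins: "{..<Suc m} = insert m {..<m}" by (rule lessThan_Suc)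
  have "emeasure (Rn_lborel (Suc m)) ?E = (\<integral>\<^sup>+x. indicator ?E x \<partial>Rn_lborel (Suc m))"
    using E by simp
  also have "\<dots> = (\<integral>\<^sup>+y. (\<integral>\<^sup>+x. indicator ?E (x(m := y)) \<partial>Rn_lborel m) \<partial>lborel)"
    using E unfolding ins by (intro product_nn_integral_insert_rev) auto
  also have "\<dots> = (\<integral>\<^sup>+y. ennreal (unit_ball_vol m * F y ^ m) * indicator {y. F y > 0} y \<partial>lborel)"
  proof (rule nn_integral_cong)
    fix y
    have "(\<integral>\<^sup>+x. indicator ?E (x(m := y)) \<partial>Rn_lborel m) = (\<integral>\<^sup>+x. indicator (Rn_ball m (Rn_zero m) (F y)) x \<partial>Rn_lborel m)"
      by (intro nn_integral_cong)
         (auto simp: indicator_def Rn_ball_def Rn_zero_def space_PiM L2_set_def PiE_iff extensional_def)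
    also have "\<dots> = emeasure (Rn_lborel m) (Rn_ball m (Rn_zero m) (F y))" by simp
    also have "\<dots> = ennreal (unit_ball_vol m * F y ^ m) * indicator {y. F y > 0} y"
    proof (cases "F y > 0")
      case True
      then show ?thesis by (simp add: emeasure_Rn_ball)
    next
      case False
      then have "Rn_ball m (Rn_zero m) (F y) = {}"
        by (auto simp: Rn_ball_def not_less intro: order_trans[OF _ L2_set_nonneg])
      then show ?thesis using False by simp
    qed
    finally show "(\<integral>\<^sup>+x. indicator ?E (x(m := y)) \<partial>Rn_lborel m) = \<dots>" .
  qed
  finally show ?thesis by (simp add: space_PiM)
qed

text \<open>The unit ball lies in the cylinder of height 2 over the unit ball of one dimension
  less.\<close>

lemma unit_ball_vol_Suc_le: "unit_ball_vol (real (Suc m)) \<le> 2 * unit_ball_vol (real m)"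
proof -
  define F :: "real \<Rightarrow> real" where "F = indicator {-1<..<1}"
  have "Rn_ball (Suc m) (Rn_zero (Suc m)) 1 \<subseteq> {x \<in> Rn (Suc m). L2_set x {..<m} < F (x m)}"
  proof
    fix x assume x: "x \<in> Rn_ball (Suc m) (Rn_zero (Suc m)) 1"
    then have "(\<Sum>i<m. (x i)\<^sup>2) + (x m)\<^sup>2 < 1"
      by (simp add: Rn_ball_def Rn_zero_def L2_set_less_iff)
    moreover from this have "(\<Sum>i<m. (x i)\<^sup>2) < 1" using zero_le_power2[of "x m"] by linarith
    moreover have "(\<Sum>i<m. (x i)\<^sup>2) \<ge> 0" by (intro sum_nonneg) auto
    ultimately have "(x m)\<^sup>2 < 1" "L2_set x {..<m} < 1" by (auto simp: L2_set_less_iff)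
    then show "x \<in> {x \<in> Rn (Suc m). L2_set x {..<m} < F (x m)}"
      using x unfolding F_def Rn_ball_def abs_square_less_1 abs_less_iff by simp
  qed
  then have "emeasure (Rn_lborel (Suc m)) (Rn_ball (Suc m) (Rn_zero (Suc m)) 1)
    \<le> emeasure (Rn_lborel (Suc m)) {x \<in> Rn (Suc m). L2_set x {..<m} < F (x m)}"
  proof (rule emeasure_mono)
    have "{x \<in> space (Rn_lborel (Suc m)). L2_set x {..<m} < F (x m)} \<in> sets (Rn_lborel (Suc m))"
      unfolding L2_set_def F_def by measurable
    then show "{x \<in> Rn (Suc m). L2_set x {..<m} < F (x m)} \<in> sets (Rn_lborel (Suc m))"
      by (simp add: space_PiM)
  qed
  also have "\<dots> = (\<integral>\<^sup>+y. ennreal (unit_ball_vol m * F y ^ m) * indicator {y. F y > 0} y \<partial>lborel)"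
    by (rule emeasure_graph) (simp add: F_def)
  also have "\<dots> = (\<integral>\<^sup>+y. ennreal (unit_ball_vol m) * indicator {-1<..<1::real} y \<partial>lborel)"
    by (intro nn_integral_cong) (auto simp: F_def indicator_def)
  also have "\<dots> = ennreal (2 * unit_ball_vol m)"
    by (subst nn_integral_cmult_indicator) (auto simp: ennreal_mult'' mult.commute)
  finally show ?thesis by (simp add: emeasure_Rn_ball)
qed

section \<open>Rotation invariance\<close>

definition householder :: "'i set \<Rightarrow> ('i \<Rightarrow> real) \<Rightarrow> ('i \<Rightarrow> real) \<Rightarrow> 'i \<Rightarrow> real" where
  "householder I w x = (\<lambda>i\<in>I. x i - 2 * (\<Sum>j\<in>I. w j * x j) / (\<Sum>j\<in>I. (w j)\<^sup>2) * w i)"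

lemma nn_integral_lborel_uminus:
  fixes f :: "real \<Rightarrow> ennreal"
  assumes [measurable]: "f \<in> borel_measurable borel"
  shows "(\<integral>\<^sup>+x. f (- x) \<partial>lborel) = integral\<^sup>N lborel f"
  using nn_integral_real_affine[of f "-1" 0] by simp

text \<open>The coordinate \<open>x k\<close> is exchanged for \<open>z = \<Sum>j. w j * x j\<close>.\<close>

lemma nn_integral_PiM_lborel_pivot:
  fixes f :: "('i \<Rightarrow> real) \<Rightarrow> ennreal"
  assumes J: "finite J" "k \<notin> J" and [measurable]: "f \<in> borel_measurable (PiM (insert k J) (\<lambda>_. lborel))"
    and "w k \<noteq> 0"
  shows "integral\<^sup>N (PiM (insert k J) (\<lambda>_. lborel)) f = ennreal \<bar>1 / w k\<bar> *
    (\<integral>\<^sup>+z. (\<integral>\<^sup>+x. f (x(k := (z - (\<Sum>j\<in>J. w j * x j)) / w k)) \<partial>PiM J (\<lambda>_. lborel)) \<partial>lborel)"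
proof -
  interpret product_sigma_finite "\<lambda>_::'i. lborel :: real measure" by standard
  interpret J: sigma_finite_measure "PiM J (\<lambda>_. lborel :: real measure)"
    by (rule sigma_finite_PiM_lborel[OF J(1)])
  interpret P: pair_sigma_finite "lborel :: real measure" "PiM J (\<lambda>_. lborel :: real measure)" ..
  have upd: "(\<lambda>p. f ((fst p)(k := snd p))) \<in> borel_measurable (PiM J (\<lambda>_. lborel) \<Otimes>\<^sub>M lborel)"
    by measurable
  have meas: "(\<lambda>(z, x). f (x(k := (z - (\<Sum>j\<in>J. w j * x j)) / w k)))
      \<in> borel_measurable (lborel \<Otimes>\<^sub>M PiM J (\<lambda>_. lborel))"
    by measurable
  have "integral\<^sup>N (PiM (insert k J) (\<lambda>_. lborel)) f
      = (\<integral>\<^sup>+x. (\<integral>\<^sup>+y. f (x(k := y)) \<partial>lborel) \<partial>PiM J (\<lambda>_. lborel))"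
    using J by (intro product_nn_integral_insert) auto
  also have "\<dots> = (\<integral>\<^sup>+x. ennreal \<bar>1 / w k\<bar> *
      (\<integral>\<^sup>+z. f (x(k := (z - (\<Sum>j\<in>J. w j * x j)) / w k)) \<partial>lborel) \<partial>PiM J (\<lambda>_. lborel))"
  proof (rule nn_integral_cong)
    fix x assume x: "x \<in> space (PiM J (\<lambda>_. lborel :: real measure))"
    have "(\<lambda>y. f (x(k := y))) \<in> borel_measurable borel"
      using measurable_compose[OF measurable_Pair1'[OF x] upd] by simp
    from nn_integral_real_affine[OF this, of "1 / w k" "- (\<Sum>j\<in>J. w j * x j) / w k"]
    show "(\<integral>\<^sup>+y. f (x(k := y)) \<partial>lborel) = ennreal \<bar>1 / w k\<bar> *
      (\<integral>\<^sup>+z. f (x(k := (z - (\<Sum>j\<in>J. w j * x j)) / w k)) \<partial>lborel)"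
      using \<open>w k \<noteq> 0\<close> by (simp add: diff_divide_distrib)
  qed
  also have "\<dots> = ennreal \<bar>1 / w k\<bar> *
      (\<integral>\<^sup>+x. (\<integral>\<^sup>+z. f (x(k := (z - (\<Sum>j\<in>J. w j * x j)) / w k)) \<partial>lborel) \<partial>PiM J (\<lambda>_. lborel))"
    by (intro nn_integral_cmult) measurable
  also have "(\<integral>\<^sup>+x. (\<integral>\<^sup>+z. f (x(k := (z - (\<Sum>j\<in>J. w j * x j)) / w k)) \<partial>lborel) \<partial>PiM J (\<lambda>_. lborel))
     = (\<integral>\<^sup>+z. (\<integral>\<^sup>+x. f (x(k := (z - (\<Sum>j\<in>J. w j * x j)) / w k)) \<partial>PiM J (\<lambda>_. lborel)) \<partial>lborel)"
    using P.Fubini'[OF meas] by simp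
  finally show ?thesis .
qed

text \<open>
  In the coordinates of the previous lemma, the reflection is \<open>z \<mapsto> - z\<close> combined with a translation
  of the remaining coordinates that depends only on \<open>z\<close>.
\<close>

lemma nn_integral_householder:
  assumes I: "finite I" "k \<in> I" and f [measurable]: "f \<in> borel_measurable (PiM I (\<lambda>_. lborel))"
    and w: "w k \<noteq> 0"
  shows "(\<integral>\<^sup>+x. f (householder I w x) \<partial>PiM I (\<lambda>_. lborel)) = integral\<^sup>N (PiM I (\<lambda>_. lborel)) f"
proof -
  define J where "J = I - {k}"
  have J: "finite J" "k \<notin> J" "insert k J = I" using I by (auto simp: J_def)
  define N where "N = (\<Sum>j\<in>I. (w j)\<^sup>2)"
  have "N > 0" unfolding N_def using I w by (intro sum_pos2[of _ k]) auto
  have N: "N = (w k)\<^sup>2 + (\<Sum>j\<in>J. (w j)\<^sup>2)" using J unfolding N_def J(3)[symmetric] by simp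
  define P where "P z x = x(k := (z - (\<Sum>j\<in>J. w j * x j)) / w k)" for z and x :: "'a \<Rightarrow> real"
  interpret J: sigma_finite_measure "PiM J (\<lambda>_. lborel :: real measure)"
    by (rule sigma_finite_PiM_lborel[OF J(1)])
  have P: "(\<lambda>(z, x). f (P z x)) \<in> borel_measurable (lborel \<Otimes>\<^sub>M PiM J (\<lambda>_. lborel))"
    using f unfolding P_def J(3)[symmetric] by measurable
  have hh: "(\<lambda>x. f (householder I w x)) \<in> borel_measurable (PiM I (\<lambda>_. lborel))"
    unfolding householder_def using I by measurable
  have house: "householder I w (P z x) = P (- z) (\<lambda>i\<in>J. x i + - (2 * z / N) * w i)"
    if "x \<in> space (PiM J (\<lambda>_. lborel :: real measure))" for z x
  proof (rule ext)
    fix i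
    have "(\<Sum>j\<in>J. w j * P z x j) = (\<Sum>j\<in>J. w j * x j)"
      using J by (intro sum.cong) (auto simp: P_def)
    then have z: "(\<Sum>j\<in>I. w j * P z x j) = z" using J w unfolding J(3)[symmetric] by (simp add: P_def)
    have "(\<Sum>j\<in>J. w j * (\<lambda>i\<in>J. x i + - (2 * z / N) * w i) j) = (\<Sum>j\<in>J. w j * x j) - 2 * z / N * (\<Sum>j\<in>J. (w j)\<^sup>2)"
      by (simp add: algebra_simps sum_distrib_left sum_subtractf power2_eq_square)
    also have "\<dots> = (\<Sum>j\<in>J. w j * x j) - 2 * z + 2 * z / N * (w k)\<^sup>2"
      using \<open>N > 0\<close> N by (simp add: field_simps)
    finally have S: "(\<Sum>j\<in>J. w j * (\<lambda>i\<in>J. x i + - (2 * z / N) * w i) j)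
      = (\<Sum>j\<in>J. w j * x j) - 2 * z + 2 * z / N * (w k)\<^sup>2" .
    \<comment> \<open>Solving for coordinate \<open>k\<close> from \<open>- z\<close> and the
      translated rest gives the reflected coordinate: the term with \<open>(w k)\<^sup>2\<close>,
      left over from \<open>N\<close>, supplies its shift.\<close>
    have k: "(- z - (\<Sum>j\<in>J. w j * (\<lambda>i\<in>J. x i + - (2 * z / N) * w i) j)) / w k
        = (z - (\<Sum>j\<in>J. w j * x j)) / w k - 2 * z / N * w k"
      unfolding S using w by (simp add: diff_divide_distrib add_divide_distrib power2_eq_square)
    show "householder I w (P z x) i = P (- z) (\<lambda>i\<in>J. x i + - (2 * z / N) * w i) i"
    proof (cases "i = k")
      case True
      then show ?thesis using I k z unfolding householder_def P_def[of "- z"] N_def[symmetric]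
        by (simp add: P_def)
    next
      case False
      then show ?thesis using z unfolding householder_def N_def[symmetric]
        by (auto simp: P_def J_def restrict_def)
    qed
  qed
  have pivot: "integral\<^sup>N (PiM I (\<lambda>_. lborel)) g = ennreal \<bar>1 / w k\<bar> *
    (\<integral>\<^sup>+z. (\<integral>\<^sup>+x. g (P z x) \<partial>PiM J (\<lambda>_. lborel)) \<partial>lborel)"
    if "g \<in> borel_measurable (PiM I (\<lambda>_. lborel))" for g
    using nn_integral_PiM_lborel_pivot[OF J(1,2), of g w] that w unfolding J(3) P_def by simp
  have "(\<integral>\<^sup>+x. f (householder I w x) \<partial>PiM I (\<lambda>_. lborel)) = ennreal \<bar>1 / w k\<bar> *
    (\<integral>\<^sup>+z. (\<integral>\<^sup>+x. f (P (- z) (\<lambda>i\<in>J. x i + - (2 * z / N) * w i)) \<partial>PiM J (\<lambda>_. lborel)) \<partial>lborel)"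
    unfolding pivot[OF hh] by (intro arg_cong2[where f = "(*)"] nn_integral_cong refl) (simp add: house)
  also have "\<dots> = ennreal \<bar>1 / w k\<bar> * (\<integral>\<^sup>+z. (\<integral>\<^sup>+x. f (P (- z) x) \<partial>PiM J (\<lambda>_. lborel)) \<partial>lborel)"
  proof (rule arg_cong2[where f = "(*)", OF refl], rule nn_integral_cong)
    fix z :: real
    have "(\<lambda>x. f (P (- z) x)) \<in> borel_measurable (PiM J (\<lambda>_. lborel))"
      using measurable_compose[OF measurable_Pair1'[of "- z" lborel] P] by simp
    from nn_integral_PiM_lborel_translate[OF J(1) this]
    show "(\<integral>\<^sup>+x. f (P (- z) (\<lambda>i\<in>J. x i + - (2 * z / N) * w i)) \<partial>PiM J (\<lambda>_. lborel))
      = (\<integral>\<^sup>+x. f (P (- z) x) \<partial>PiM J (\<lambda>_. lborel))" .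
  qed
  also have "(\<integral>\<^sup>+z. (\<integral>\<^sup>+x. f (P (- z) x) \<partial>PiM J (\<lambda>_. lborel)) \<partial>lborel)
     = (\<integral>\<^sup>+z. (\<integral>\<^sup>+x. f (P z x) \<partial>PiM J (\<lambda>_. lborel)) \<partial>lborel)"
    by (rule nn_integral_lborel_uminus) (use J.borel_measurable_nn_integral[OF P] in simp)
  also have "ennreal \<bar>1 / w k\<bar> * \<dots> = integral\<^sup>N (PiM I (\<lambda>_. lborel)) f"
    by (rule pivot[OF f, symmetric])
  finally show ?thesis .
qed

text \<open>The reflection along \<open>c - c'\<close> is an isometry fixing the origin, and for
  centres of equal norm it maps \<open>c\<close> to \<open>c'\<close>.\<close>

lemma householder_dist:
  assumes eq: "(\<Sum>i\<in>I. (c i)\<^sup>2) = (\<Sum>i\<in>I. (c' i)\<^sup>2)" and w: "\<And>i. w i = c i - c' i"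
    and N: "(\<Sum>i\<in>I. (w i)\<^sup>2) \<noteq> 0"
  shows "L2_set (\<lambda>i. householder I w x i - c' i) I = L2_set (\<lambda>i. x i - c i) I"
    and "L2_set (householder I w x) I = L2_set x I"
proof -
  define n where "n = (\<Sum>i\<in>I. (w i)\<^sup>2)"
  define s where "s = (\<Sum>i\<in>I. w i * x i)"
  define l where "l = 2 * s / n"
  define d where "d = (\<Sum>i\<in>I. w i * c' i)"
  have h: "householder I w x i = x i - l * w i" if "i \<in> I" for i
    using that by (simp add: householder_def l_def s_def n_def)
  have ln: "l * n = 2 * s" using N by (simp add: l_def n_def)
  have "(\<Sum>i\<in>I. (c i)\<^sup>2) = (\<Sum>i\<in>I. (c' i)\<^sup>2) + 2 * d + n"
    unfolding d_def n_def by (simp add: w sum.distrib[symmetric] sum_distrib_left power2_eq_square algebra_simps)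
  \<comment> \<open>Equal norms enter here: expanding the square of \<open>c = c' + w\<close> leaves
    \<open>2 * d + n = 0\<close>.\<close>
  then have d: "2 * d = - n" using eq by simp
  have "(\<Sum>i\<in>I. (x i - l * w i - c' i)\<^sup>2) = (\<Sum>i\<in>I. (x i - c i)\<^sup>2) + l * (l * n) - 2 * l * s + (l - 1) * (2 * d) + 2 * s - n"
    unfolding d_def n_def s_def
    by (simp add: w sum.distrib[symmetric] sum_subtractf[symmetric] sum_distrib_left power2_eq_square algebra_simps)
  also have "\<dots> = (\<Sum>i\<in>I. (x i - c i)\<^sup>2)" unfolding d ln using ln by (simp add: algebra_simps)
  finally show "L2_set (\<lambda>i. householder I w x i - c' i) I = L2_set (\<lambda>i. x i - c i) I"
    by (simp add: L2_set_def h)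
  have "(\<Sum>i\<in>I. (x i - l * w i)\<^sup>2) = (\<Sum>i\<in>I. (x i)\<^sup>2) + l * (l * n) - 2 * l * s"
    unfolding n_def s_def
    by (simp add: sum.distrib[symmetric] sum_subtractf[symmetric] sum_distrib_left power2_eq_square algebra_simps)
  also have "\<dots> = (\<Sum>i\<in>I. (x i)\<^sup>2)" unfolding ln by simp
  finally show "L2_set (householder I w x) I = L2_set x I"
    by (simp add: L2_set_def h)
qed

text \<open>A ball about the origin is invariant under reflections, so a single reflection
  exchanging the two centres does the work of a general rotation. If the centres agree there is no
  vector to reflect along, whence the case split.\<close>

lemma emeasure_lens_rotate:
  assumes "L2_set c {..<n} = L2_set c' {..<n}"
  shows "emeasure (Rn_lborel n) (Rn_ball n (Rn_zero n) A \<inter> Rn_ball n c B)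
       = emeasure (Rn_lborel n) (Rn_ball n (Rn_zero n) A \<inter> Rn_ball n c' B)"
proof (cases "\<forall>i<n. c i = c' i")
  case True
  then have "Rn_ball n c B = Rn_ball n c' B" by (simp add: Rn_ball_def L2_set_def)
  then show ?thesis by simp
next
  case False
  then obtain k where k: "k < n" "c k \<noteq> c' k" by auto
  define w where "w i = c i - c' i" for i
  have wk: "w k \<noteq> 0" using k by (simp add: w_def)
  have N: "(\<Sum>i<n. (w i)\<^sup>2) \<noteq> 0"
    using sum_pos2[of "{..<n}" k "\<lambda>i. (w i)\<^sup>2"] k wk by simp
  have eq: "(\<Sum>i<n. (c i)\<^sup>2) = (\<Sum>i<n. (c' i)\<^sup>2)"
    using assms by (simp add: L2_set_def)
  let ?E = "\<lambda>c. Rn_ball n (Rn_zero n) A \<inter> Rn_ball n c B"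
  have "emeasure (Rn_lborel n) (?E c) = (\<integral>\<^sup>+x. indicator (?E c) x \<partial>Rn_lborel n)" by simp
  also have "\<dots> = (\<integral>\<^sup>+x. indicator (?E c') (householder {..<n} w x) \<partial>Rn_lborel n)"
  proof (rule nn_integral_cong)
    fix x assume "x \<in> space (Rn_lborel n)"
    moreover have "L2_set (\<lambda>i. y i - Rn_zero n i) {..<n} = L2_set y {..<n}" for y
      by (simp add: L2_set_def Rn_zero_def)
    ultimately show "indicator (?E c) x = (indicator (?E c') (householder {..<n} w x) :: ennreal)"
      using householder_dist[OF eq w_def N, of x]
      by (auto simp: indicator_def Rn_ball_def space_PiM householder_def)
  qed
  also have "\<dots> = (\<integral>\<^sup>+x. indicator (?E c') x \<partial>Rn_lborel n)"
    using k wk by (intro nn_integral_householder[of _ k]) auto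
  finally show ?thesis by simp
qed

section \<open>The lens\<close>

text \<open>Subtracting the equations of the two boundary spheres, of radii 1 and
  \<open>1 + r\<close>, leaves this value for the inner product of \<open>x\<close> with
  \<xi>.\<close>

definition lens_height :: "real \<Rightarrow> real" where
  "lens_height r = 1 - (1 + r)\<^sup>2 / 2"

lemma lens_radius_eq: "lens_radius r = sqrt (1 - (lens_height r)\<^sup>2)"
  unfolding lens_radius_def lens_height_def
  by (intro arg_cong[where f = sqrt]) (simp add: power2_eq_square field_simps)

text \<open>The bound \<open>sqrt 2 - 1\<close> on \<open>r\<close> means that the equatorial plane
  does not pass beyond the origin, seen from \<xi>.\<close>

lemma lens_height_bounds:
  assumes "0 < r" "r \<le> sqrt 2 - 1"
  shows "0 \<le> lens_height r" "lens_height r < 1 / 2"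
proof -
  have "(1 + r)\<^sup>2 \<le> (sqrt 2)\<^sup>2" using assms by (intro power_mono) auto
  then show "0 \<le> lens_height r" by (simp add: lens_height_def)
  have "1\<^sup>2 < (1 + r)\<^sup>2" using assms by (intro power_strict_mono) auto
  then show "lens_height r < 1 / 2" by (simp add: lens_height_def)
qed

lemma lens_radius_power2:
  assumes "0 < r" "r \<le> sqrt 2 - 1"
  shows "(lens_radius r)\<^sup>2 = 1 - (lens_height r)\<^sup>2"
  using lens_height_bounds[OF assms] unfolding lens_radius_eq
  by (subst real_sqrt_pow2) (auto simp: abs_square_le_1)

lemma lens_radius_pos:
  assumes "0 < r" "r \<le> sqrt 2 - 1"
  shows "0 < lens_radius r"
  using lens_height_bounds[OF assms] unfolding lens_radius_eq by (simp add: abs_square_less_1)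

text \<open>With \<open>S = (1 + r)^2 \<ge> 1\<close> the square of the left side is
  \<open>S * (4 - S) \<le> 3 * S\<close>, and \<open>3 < pi\<close>. This is where
  \<open>sqrt pi\<close> enters the final estimate.\<close>

lemma two_lens_radius_le:
  assumes "0 < r" "r \<le> sqrt 2 - 1"
  shows "2 * lens_radius r \<le> sqrt pi * (1 + r)"
proof (rule power2_le_imp_le)
  have "(2 * lens_radius r)\<^sup>2 = 4 * (1 - (lens_height r)\<^sup>2)"
    by (simp add: power_mult_distrib lens_radius_power2[OF assms])
  also have "\<dots> = (1 + r)\<^sup>2 * (4 - (1 + r)\<^sup>2)"
    by (simp add: lens_height_def power2_eq_square field_simps)
  also have "\<dots> \<le> (1 + r)\<^sup>2 * pi"
  proof (rule mult_left_mono)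
    have "1 \<le> (1 + r)\<^sup>2" using assms by (intro one_le_power) auto
    then show "4 - (1 + r)\<^sup>2 \<le> pi" using pi_gt3 by linarith
  qed simp
  finally show "(2 * lens_radius r)\<^sup>2 \<le> (sqrt pi * (1 + r))\<^sup>2"
    by (simp add: power_mult_distrib mult.commute)
qed (use assms in simp)

text \<open>With \<open>t = lens_height r\<close>, adding \<open>1 - t\<close> times the inequality
  of the unit ball to \<open>t\<close> times that of the ball about \<xi> gives exactly the
  inequality of the ball about \<open>t\<close> times \<xi>. The weights are legitimate because
  \<open>0 \<le> t < 1\<close>.\<close>

lemma Rn_lens_subset_ball:
  assumes r: "0 < r" "r \<le> sqrt 2 - 1" and xi: "\<xi> \<in> Rn_sphere n"
  shows "Rn_ball n (Rn_zero n) 1 \<inter> Rn_ball n (Rn_scale n 1 \<xi>) (1 + r)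
    \<subseteq> Rn_ball n (Rn_scale n (lens_height r) \<xi>) (lens_radius r)"
proof
  fix x assume x: "x \<in> Rn_ball n (Rn_zero n) 1 \<inter> Rn_ball n (Rn_scale n 1 \<xi>) (1 + r)"
  define t where "t = lens_height r"
  have t: "0 \<le> t" "t < 1" using lens_height_bounds[OF r] by (auto simp: t_def)
  define d where "d = (\<Sum>i<n. x i * \<xi> i)"
  have norm_xi: "(\<Sum>i<n. (\<xi> i)\<^sup>2) = 1" using xi by (simp add: Rn_sphere_def L2_set_def)
  have expand: "(\<Sum>i<n. (x i - a * \<xi> i)\<^sup>2) = (\<Sum>i<n. (x i)\<^sup>2) - 2 * a * d + a\<^sup>2" for a
  proof -
    have "(\<Sum>i<n. (x i - a * \<xi> i)\<^sup>2) = (\<Sum>i<n. (x i)\<^sup>2) - 2 * a * d + a\<^sup>2 * (\<Sum>i<n. (\<xi> i)\<^sup>2)"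
      unfolding d_def
      by (simp add: sum.distrib[symmetric] sum_subtractf[symmetric] sum_distrib_left power2_eq_square algebra_simps)
    then show ?thesis by (simp add: norm_xi)
  qed
  have 1: "(\<Sum>i<n. (x i)\<^sup>2) < 1" using x by (simp add: Rn_ball_def Rn_zero_def L2_set_less_iff)
  have "(\<Sum>i<n. (x i - 1 * \<xi> i)\<^sup>2) < (1 + r)\<^sup>2"
    using x r by (simp add: Rn_ball_def Rn_scale_def L2_set_less_iff)
  then have 2: "(\<Sum>i<n. (x i)\<^sup>2) - 2 * d + 1 < 2 - 2 * t"
    unfolding expand by (simp add: t_def lens_height_def)
  have "(1 - t) * (\<Sum>i<n. (x i)\<^sup>2) + t * ((\<Sum>i<n. (x i)\<^sup>2) - 2 * d + 1) < (1 - t) * 1 + t * (2 - 2 * t)"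
    using 1 2 t by (intro add_less_le_mono mult_strict_left_mono mult_left_mono) auto
  then have "(\<Sum>i<n. (x i - t * \<xi> i)\<^sup>2) < 1 - t\<^sup>2"
    unfolding expand by (simp add: algebra_simps power2_eq_square)
  then have "(\<Sum>i<n. (x i - t * \<xi> i)\<^sup>2) < (lens_radius r)\<^sup>2"
    by (simp add: lens_radius_power2[OF r] t_def)
  then show "x \<in> Rn_ball n (Rn_scale n (lens_height r) \<xi>) (lens_radius r)"
    using x by (simp add: Rn_ball_def Rn_scale_def L2_set_less_iff[OF lens_radius_pos[OF r]] t_def)
qed

text \<open>Up to the factor \<open>unit_ball_vol m\<close>, this is the volume of a double cone
  with base radius \<open>H\<close> and total height \<open>b - a\<close>; the position
  \<open>t\<close> of the base cancels.\<close>

lemma nn_integral_tent: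
  fixes a t b H :: real
  assumes "a < t" "t < b" "0 \<le> H"
  shows "(\<integral>\<^sup>+y. ennreal ((H * min ((y - a) / (t - a)) ((b - y) / (b - t))) ^ m) * indicator {a<..<b} y \<partial>lborel)
    \<ge> ennreal (H ^ m * (b - a) / (m + 1))"
proof -
  define F where "F y = H * min ((y - a) / (t - a)) ((b - y) / (b - t))" for y
  have affine_power: "((\<lambda>y. H ^ m / c / (m + 1) * l y ^ Suc m) has_real_derivative (H * l y) ^ m) (at y)"
    if "c \<noteq> 0" and l: "(l has_real_derivative c) (at y)" for c :: real and l y
  proof -
    have "((\<lambda>y. H ^ m / c / (m + 1) * l y ^ Suc m) has_real_derivative
        H ^ m / c / (m + 1) * ((1 + real m) * (c * l y ^ m))) (at y)"
      by (rule DERIV_cmult[OF DERIV_power_Suc[OF l]])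
    moreover have "H ^ m / c / (m + 1) * ((1 + real m) * (c * l y ^ m)) = (H * l y) ^ m"
      using that(1) by (simp add: power_mult_distrib divide_simps)
    ultimately show ?thesis by simp
  qed
  have left: "(\<integral>\<^sup>+y. ennreal ((H * ((y - a) / (t - a))) ^ m) * indicator {a..t} y \<partial>lborel)
     = ennreal (H ^ m * (t - a) / (m + 1))"
  proof -
    have "(\<integral>\<^sup>+y. ennreal ((H * ((y - a) / (t - a))) ^ m) * indicator {a..t} y \<partial>lborel)
      = ennreal (H ^ m * (t - a) / (m + 1) * ((t - a) / (t - a)) ^ Suc m - H ^ m * (t - a) / (m + 1) * ((a - a) / (t - a)) ^ Suc m)"
    proof (rule nn_integral_FTC_Icc)
      fix y assume "y \<in> {a..t}"
      show "((\<lambda>y. H ^ m * (t - a) / (m + 1) * ((y - a) / (t - a)) ^ Suc m) has_real_derivative (H * ((y - a) / (t - a))) ^ m) (at y)"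
        using affine_power[of "1 / (t - a)" "\<lambda>y. (y - a) / (t - a)" y, OF _ DERIV_cdivide[OF DERIV_diff[OF DERIV_ident DERIV_const], simplified]] assms by simp
    qed (use assms in auto)
    then show ?thesis using assms by simp
  qed
  have right: "(\<integral>\<^sup>+y. ennreal ((H * ((b - y) / (b - t))) ^ m) * indicator {t..b} y \<partial>lborel)
     = ennreal (H ^ m * (b - t) / (m + 1))"
  proof -
    have "(\<integral>\<^sup>+y. ennreal ((H * ((b - y) / (b - t))) ^ m) * indicator {t..b} y \<partial>lborel)
      = ennreal (- (H ^ m * (b - t) / (m + 1)) * ((b - b) / (b - t)) ^ Suc m - - (H ^ m * (b - t) / (m + 1)) * ((b - t) / (b - t)) ^ Suc m)"
    proof (rule nn_integral_FTC_Icc)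
      fix y assume "y \<in> {t..b}"
      show "((\<lambda>y. - (H ^ m * (b - t) / (m + 1)) * ((b - y) / (b - t)) ^ Suc m) has_real_derivative (H * ((b - y) / (b - t))) ^ m) (at y)"
        using affine_power[of "- (1 / (b - t))" "\<lambda>y. (b - y) / (b - t)" y, OF _ DERIV_cdivide[OF DERIV_diff[OF DERIV_const DERIV_ident], simplified]] assms by simp
    qed (use assms in auto)
    then show ?thesis using assms by simp
  qed
  have "ennreal (H ^ m * (b - a) / (m + 1)) = ennreal (H ^ m * (t - a) / (m + 1)) + ennreal (H ^ m * (b - t) / (m + 1))"
    using assms by (subst ennreal_plus[symmetric])
      (auto simp: add_divide_distrib[symmetric] distrib_left[symmetric])
  also have "\<dots> = (\<integral>\<^sup>+y. ennreal ((H * ((y - a) / (t - a))) ^ m) * indicator {a..t} y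
      + ennreal ((H * ((b - y) / (b - t))) ^ m) * indicator {t..b} y \<partial>lborel)"
    unfolding left[symmetric] right[symmetric] by (rule nn_integral_add[symmetric]) auto
  also have "\<dots> \<le> (\<integral>\<^sup>+y. ennreal (F y ^ m) * indicator {a<..<b} y \<partial>lborel)"
  proof (rule nn_integral_mono_AE)
    \<comment> \<open>At \<open>t\<close> both pieces are counted, and at \<open>a\<close> and
      \<open>b\<close> the right-hand side vanishes; these points form a null set.\<close>
    have "AE y in lborel. y \<notin> {a, t, b}"
      by (intro AE_not_in countable_imp_null_set_lborel) auto
    then show "AE y in lborel. ennreal ((H * ((y - a) / (t - a))) ^ m) * indicator {a..t} y
      + ennreal ((H * ((b - y) / (b - t))) ^ m) * indicator {t..b} y \<le> ennreal (F y ^ m) * indicator {a<..<b} y"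
    proof eventually_elim
      case (elim y)
      show ?case
      proof (cases "y < t")
        case True
        then have "(y - a) / (t - a) \<le> 1" "1 \<le> (b - y) / (b - t)" using assms by auto
        then have "F y = H * ((y - a) / (t - a))" unfolding F_def by (simp add: min_absorb1)
        then show ?thesis using elim True assms by (auto simp: indicator_def)
      next
        case False
        then have "(b - y) / (b - t) \<le> 1" "1 \<le> (y - a) / (t - a)" using assms elim by auto
        then have "F y = H * ((b - y) / (b - t))" unfolding F_def by (simp add: min_absorb2)
        then show ?thesis using elim False assms by (auto simp: indicator_def)
      qed
    qed
  qed
  finally show ?thesis by (simp add: F_def)
qed

text \<open>The axis is the last coordinate, along which \<open>emeasure_graph\<close>
  slices.\<close>

definition Rn_pole :: "nat \<Rightarrow> nat \<Rightarrow> real" where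
  "Rn_pole m = (\<lambda>i\<in>{..<Suc m}. if i = m then 1 else 0)"

lemma Rn_pole_sphere: "Rn_pole m \<in> Rn_sphere (Suc m)"
  by (simp add: Rn_pole_def Rn_sphere_def L2_set_def)

text \<open>The lens contains the double cone over its equatorial disc with apexes \<open>\<xi>\<close> and \<open>-r \<xi>\<close>.\<close>

lemma double_cone_planar:
  assumes r: "0 < r" "r \<le> sqrt 2 - 1" and q: "0 \<le> q"
    and qy: "q < lens_radius r * min ((y + r) / (lens_height r + r)) ((1 - y) / (1 - lens_height r))"
    and y: "- r < y" "y < 1"
  shows "q\<^sup>2 + y\<^sup>2 < 1" "q\<^sup>2 + (y - 1)\<^sup>2 < (1 + r)\<^sup>2"
proof -
  define t h where "t = lens_height r" and "h = lens_radius r"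
  have t: "0 \<le> t" "t < 1 / 2" using lens_height_bounds[OF r] by (auto simp: t_def)
  have h: "h > 0" "h\<^sup>2 + t\<^sup>2 = 1" using lens_radius_pos[OF r] lens_radius_power2[OF r] by (auto simp: h_def t_def)
  have S: "(1 + r)\<^sup>2 = 2 - 2 * t" by (simp add: t_def lens_height_def)
  have "sqrt 2 < 2" by (rule sqrt2_less_2)
  then have r1: "r < 1" using r by simp
  have "h * min u v \<le> h * u" "h * min u v \<le> h * v" for u v
    using h by (auto intro!: mult_left_mono)
  then have ql: "q < h * ((y + r) / (t + r))" "q < h * ((1 - y) / (1 - t))"
    using qy unfolding t_def[symmetric] h_def[symmetric] by (blast intro: less_le_trans)+
  have sq: "q\<^sup>2 < l\<^sup>2 * h\<^sup>2" if "q < h * l" for l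
    using power_strict_mono[OF that q, of 2] by (simp add: power_mult_distrib mult.commute)
  show *: "q\<^sup>2 + y\<^sup>2 < 1"
  proof (cases "y \<le> t")
    case True
    \<comment> \<open>Height \<open>y\<close> is the convex combination of the equator height
      \<open>t\<close>, with weight \<open>l\<close>, and the apex \<open>- r\<close>, while
      \<open>q < l * h\<close>. Equator and apex both have norm at most 1.\<close>
    define l where "l = (y + r) / (t + r)"
    have l: "0 \<le> l" "l \<le> 1" using True t r y by (auto simp: l_def)
    have lt: "l * (t + r) = y + r" using t r by (simp add: l_def)
    have ly: "y = l * t - (1 - l) * r" using lt by (simp add: algebra_simps)
    have "q\<^sup>2 + y\<^sup>2 < l\<^sup>2 * h\<^sup>2 + (l * t - (1 - l) * r)\<^sup>2"
      unfolding ly using sq[of l] ql by (simp add: l_def[symmetric])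
    also have "\<dots> = l\<^sup>2 * (h\<^sup>2 + t\<^sup>2) - 2 * l * (1 - l) * (t * r) + (1 - l)\<^sup>2 * r\<^sup>2"
      by (simp add: power2_eq_square algebra_simps)
    also have "\<dots> \<le> l\<^sup>2 + (1 - l)\<^sup>2 * 1"
      using l t r r1 unfolding h(2)
      by (intro add_mono mult_left_mono) (auto simp: power_le_one)
    also have "\<dots> = 1 - 2 * (l * (1 - l))" by (simp add: power2_eq_square algebra_simps)
    also have "\<dots> \<le> 1" using l by simp
    finally show ?thesis .
  next
    case False
    define l where "l = (1 - y) / (1 - t)"
    have l: "0 \<le> l" "l \<le> 1" using False t r y by (auto simp: l_def)
    have lt: "l * (1 - t) = 1 - y" using t r by (simp add: l_def)
    have ly: "y = l * t + (1 - l)" using lt by (simp add: algebra_simps)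
    have "q\<^sup>2 + y\<^sup>2 < l\<^sup>2 * h\<^sup>2 + (l * t + (1 - l))\<^sup>2"
      unfolding ly using sq[of l] ql by (simp add: l_def[symmetric])
    also have "\<dots> = l\<^sup>2 * (h\<^sup>2 + t\<^sup>2) + 2 * (l * (1 - l)) * t + (1 - l)\<^sup>2"
      by (simp add: power2_eq_square algebra_simps)
    also have "\<dots> \<le> l\<^sup>2 + 2 * (l * (1 - l)) * 1 + (1 - l)\<^sup>2"
      using l t r r1 unfolding h(2)
      by (intro add_mono mult_left_mono) auto
    also have "\<dots> = 1" by (simp add: power2_eq_square algebra_simps)
    finally show ?thesis .
  qed
  show "q\<^sup>2 + (y - 1)\<^sup>2 < (1 + r)\<^sup>2"
  proof (cases "y \<le> t")
    case True
    \<comment> \<open>Equator and apex \<open>- r\<close> are both at distance \<open>1 + r\<close>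
      from \<xi>; the mixed term is controlled by \<open>1 - t \<le> 1 + r\<close>.\<close>
    define l where "l = (y + r) / (t + r)"
    have l: "0 \<le> l" "l \<le> 1" using True t r y by (auto simp: l_def)
    have lt: "l * (t + r) = y + r" using t r by (simp add: l_def)
    have ly: "y - 1 = - (l * (1 - t) + (1 - l) * (1 + r))" using lt by (simp add: algebra_simps)
    have "q\<^sup>2 + (y - 1)\<^sup>2 < l\<^sup>2 * h\<^sup>2 + (l * (1 - t) + (1 - l) * (1 + r))\<^sup>2"
      unfolding ly power2_minus using sq[of l] ql by (simp add: l_def[symmetric])
    also have "\<dots> = l\<^sup>2 * (h\<^sup>2 + t\<^sup>2 + 1 - 2 * t) + 2 * (l * (1 - l) * (1 + r)) * (1 - t) + (1 - l)\<^sup>2 * (1 + r)\<^sup>2"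
      by (simp add: power2_eq_square algebra_simps)
    also have "\<dots> \<le> l\<^sup>2 * (1 + r)\<^sup>2 + 2 * (l * (1 - l) * (1 + r)) * (1 + r) + (1 - l)\<^sup>2 * (1 + r)\<^sup>2"
      using l t r r1 unfolding h(2) S
      by (intro add_mono mult_left_mono) auto
    also have "\<dots> = (1 + r)\<^sup>2" by (simp add: power2_eq_square algebra_simps)
    finally show ?thesis .
  next
    case False
    \<comment> \<open>Here the squared distance to \<xi> is
      \<open>q\<^sup>2 + y\<^sup>2 + 1 - 2 * y\<close>, below \<open>2 - 2 * t\<close> since
      \<open>y > t\<close>.\<close>
    then show ?thesis using * unfolding S by (simp add: power2_eq_square algebra_simps)
  qed
qed

text \<open>For a centre on the axis, membership depends only on the distance to the axis and the
  height. In units of \<open>R\<close> these are the planar coordinates of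
  \<open>double_cone_planar\<close>.\<close>

lemma Rn_scale_ball_iff:
  assumes "0 < R" "0 < B"
  shows "x \<in> Rn_ball (Suc m) (Rn_scale (Suc m) R (Rn_scale (Suc m) a (Rn_pole m))) (R * B) \<longleftrightarrow>
    x \<in> Rn (Suc m) \<and> (L2_set x {..<m} / R)\<^sup>2 + (x m / R - a)\<^sup>2 < B\<^sup>2"
proof -
  have "(\<Sum>i<Suc m. (x i - Rn_scale (Suc m) R (Rn_scale (Suc m) a (Rn_pole m)) i)\<^sup>2)
     = (L2_set x {..<m})\<^sup>2 + (x m - R * a)\<^sup>2"
    by (simp add: Rn_scale_def Rn_pole_def L2_set_def sum_nonneg)
  also have "\<dots> = R\<^sup>2 * ((L2_set x {..<m} / R)\<^sup>2 + (x m / R - a)\<^sup>2)"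
    using assms by (simp add: field_simps power2_eq_square)
  finally show ?thesis using assms
    by (auto simp: Rn_ball_def L2_set_less_iff power_mult_distrib)
qed

text \<open>For \<open>R = 1\<close> and \<open>n = Suc m\<close> the double cone has volume
  \<open>unit_ball_vol m * lens_radius r ^ m * (1 + r) / n\<close>. Now
  \<open>unit_ball_vol_Suc_le\<close> and \<open>two_lens_radius_le\<close> trade
  \<open>unit_ball_vol m * (1 + r)\<close> for
  \<open>unit_ball_vol n * lens_radius r / sqrt pi\<close>.\<close>

lemma emeasure_lens_pole_ge:
  assumes r: "0 < r" "r \<le> sqrt 2 - 1" and R: "0 < R"
  shows "emeasure (Rn_lborel (Suc m)) (Rn_ball (Suc m) (Rn_zero (Suc m)) R \<inter>
      Rn_ball (Suc m) (Rn_scale (Suc m) R (Rn_pole m)) (R + R * r))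
    \<ge> ennreal (unit_ball_vol (Suc m) * (R * lens_radius r) ^ Suc m / (sqrt pi * Suc m))"
proof -
  define n where "n = Suc m"
  \<comment> \<open>The radius of the double cone at height \<open>y\<close>, after scaling by
    \<open>R\<close>.\<close>
  define F where "F y = R * lens_radius r * min ((y - (- (R * r))) / (R * lens_height r - (- (R * r))))
     ((R - y) / (R - R * lens_height r))" for y
  have t: "0 \<le> lens_height r" "lens_height r < 1 / 2" using lens_height_bounds[OF r] by auto
  have h: "lens_radius r > 0" by (rule lens_radius_pos[OF r])
  have a: "- (R * r) < R * lens_height r" "R * lens_height r < R"
  proof -
    have "0 < R * r" "0 \<le> R * lens_height r" using R r t by simp_all
    then show "- (R * r) < R * lens_height r" by linarith
    show "R * lens_height r < R" using R t by simp
  qed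
  have F_pos: "{y. F y > 0} = {- (R * r)<..<R}"
  proof -
    have "0 < c * x \<longleftrightarrow> 0 < x" if "0 < c" for c x :: real
      using that by (simp add: zero_less_mult_iff)
    note pos = this[OF mult_pos_pos[OF R h]]
    show ?thesis using a unfolding F_def pos by (auto simp: zero_less_divide_iff)
  qed
  have zero: "Rn_zero n = Rn_scale n R (Rn_scale n 0 (Rn_pole m))"
    and one: "Rn_scale n R (Rn_pole m) = Rn_scale n R (Rn_scale n 1 (Rn_pole m))"
    by (auto simp: Rn_zero_def Rn_scale_def)
  have sub: "{x \<in> Rn n. L2_set x {..<m} < F (x m)} \<subseteq>
    Rn_ball n (Rn_zero n) R \<inter> Rn_ball n (Rn_scale n R (Rn_pole m)) (R + R * r)"
  proof
    fix x assume x: "x \<in> {x \<in> Rn n. L2_set x {..<m} < F (x m)}"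
    have "F (x m) > 0" using x by (auto intro: le_less_trans[OF L2_set_nonneg])
    then have "x m \<in> {- (R * r)<..<R}" using F_pos by auto
    then have y: "- r < x m / R" "x m / R < 1" using R by (auto simp: field_simps)
    have "F (x m) = R * (lens_radius r * min ((x m / R + r) / (lens_height r + r)) ((1 - x m / R) / (1 - lens_height r)))"
    proof -
      have "(x m - (- (R * r))) / (R * lens_height r - (- (R * r))) = (R * (x m / R + r)) / (R * (lens_height r + r))"
        using R by (simp add: algebra_simps)
      moreover have "(R - x m) / (R - R * lens_height r) = (R * (1 - x m / R)) / (R * (1 - lens_height r))"
        using R by (simp add: algebra_simps)
      ultimately show ?thesis unfolding F_def using R by simp
    qed
    then have "L2_set x {..<m} / R < lens_radius r * min ((x m / R + r) / (lens_height r + r)) ((1 - x m / R) / (1 - lens_height r))"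
      using x R by (simp add: pos_divide_less_eq mult.commute)
    from double_cone_planar[OF r _ this y]
    show "x \<in> Rn_ball n (Rn_zero n) R \<inter> Rn_ball n (Rn_scale n R (Rn_pole m)) (R + R * r)"
      using Rn_scale_ball_iff[OF R, of 1 x m 0] Rn_scale_ball_iff[OF R, of "1 + r" x m 1] x R r
      unfolding zero one unfolding n_def by (simp add: ring_distribs L2_set_nonneg)
  qed
  have "unit_ball_vol (Suc m) * lens_radius r \<le> 2 * unit_ball_vol m * lens_radius r"
    using unit_ball_vol_Suc_le[of m] h by (intro mult_right_mono) auto
  also have "\<dots> = unit_ball_vol m * (2 * lens_radius r)" by simp
  also have "\<dots> \<le> unit_ball_vol m * (sqrt pi * (1 + r))"
    using two_lens_radius_le[OF r] by (intro mult_left_mono) auto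
  finally have vol: "unit_ball_vol (Suc m) * lens_radius r / sqrt pi \<le> unit_ball_vol m * (1 + r)"
    by (simp add: field_simps)
  have "unit_ball_vol (Suc m) * (R * lens_radius r) ^ Suc m / (sqrt pi * Suc m)
     = unit_ball_vol (Suc m) * lens_radius r / sqrt pi * (R * (R * lens_radius r) ^ m / Suc m)"
    by simp
  also have "\<dots> \<le> unit_ball_vol m * (1 + r) * (R * (R * lens_radius r) ^ m / Suc m)"
    using vol R h by (intro mult_right_mono) auto
  also have "\<dots> = unit_ball_vol m * ((R * lens_radius r) ^ m * (R - - (R * r)) / (m + 1))"
    by (simp add: field_simps)
  finally have "ennreal (unit_ball_vol (Suc m) * (R * lens_radius r) ^ Suc m / (sqrt pi * Suc m))
    \<le> ennreal (unit_ball_vol m * ((R * lens_radius r) ^ m * (R - - (R * r)) / (m + 1)))"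
    by (rule ennreal_leI)
  also have "\<dots> = ennreal (unit_ball_vol m) * ennreal ((R * lens_radius r) ^ m * (R - - (R * r)) / (m + 1))"
    by (rule ennreal_mult') simp
  also have "\<dots> \<le> ennreal (unit_ball_vol m) * (\<integral>\<^sup>+y. ennreal (F y ^ m) * indicator {- (R * r)<..<R} y \<partial>lborel)"
    unfolding F_def using a R h by (intro mult_left_mono nn_integral_tent) auto
  also have "\<dots> = (\<integral>\<^sup>+y. ennreal (unit_ball_vol m) * (ennreal (F y ^ m) * indicator {- (R * r)<..<R} y) \<partial>lborel)"
    by (rule nn_integral_cmult[symmetric]) (simp add: F_def)
  also have "\<dots> = (\<integral>\<^sup>+y. ennreal (unit_ball_vol m * F y ^ m) * indicator {y. F y > 0} y \<partial>lborel)"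
    unfolding F_pos by (simp add: ennreal_mult' mult.assoc)
  also have "\<dots> = emeasure (Rn_lborel n) {x \<in> Rn n. L2_set x {..<m} < F (x m)}"
    unfolding n_def by (rule emeasure_graph[symmetric]) (simp add: F_def)
  also have "\<dots> \<le> emeasure (Rn_lborel n) (Rn_ball n (Rn_zero n) R \<inter> Rn_ball n (Rn_scale n R (Rn_pole m)) (R + R * r))"
    by (rule emeasure_mono[OF sub]) measurable
  finally show ?thesis unfolding n_def .
qed

section \<open>The test quotient\<close>

lemma sets_unit_ball_measure [measurable_cong]: "sets (unit_ball_measure n) = sets (Rn_lborel n)"
  by (simp add: unit_ball_measure_def)

lemma Rn_ball_mono: "R \<le> S \<Longrightarrow> Rn_ball n c R \<subseteq> Rn_ball n c S"
  by (rule subsetI) (simp add: Rn_ball_def)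

lemma mem_Rn_ball_zero_iff: "x \<in> Rn_ball n (Rn_zero n) R \<longleftrightarrow> x \<in> Rn n \<and> L2_set x {..<n} < R"
  by (simp add: Rn_ball_def Rn_zero_def L2_set_def)

lemma emeasure_unit_ball_measure:
  assumes "A \<in> sets (Rn_lborel n)"
  shows "emeasure (unit_ball_measure n) A = emeasure (Rn_lborel n) (Rn_ball n (Rn_zero n) 1 \<inter> A)"
  unfolding unit_ball_measure_def using assms
  by (subst emeasure_density) (auto simp: indicator_inter_arith[symmetric])

lemma emeasure_unit_ball_measure_ball:
  assumes "0 < R" "R \<le> 1"
  shows "emeasure (unit_ball_measure n) (Rn_ball n (Rn_zero n) R) = ennreal (unit_ball_vol n * R ^ n)"
proof -
  have "Rn_ball n (Rn_zero n) 1 \<inter> Rn_ball n (Rn_zero n) R = Rn_ball n (Rn_zero n) R"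
    using Rn_ball_mono[OF assms(2)] by blast
  then show ?thesis by (simp add: emeasure_unit_ball_measure emeasure_Rn_ball assms)
qed

lemma finite_measure_unit_ball_measure: "finite_measure (unit_ball_measure n)"
proof
  have "emeasure (unit_ball_measure n) (space (unit_ball_measure n)) \<le> emeasure (Rn_lborel n) (Rn_ball n (Rn_zero n) 1)"
    using emeasure_unit_ball_measure[of "space (unit_ball_measure n)" n]
    by (simp add: unit_ball_measure_def emeasure_mono)
  then show "emeasure (unit_ball_measure n) (space (unit_ball_measure n)) \<noteq> \<infinity>"
    by (auto simp: emeasure_Rn_ball top_unique)
qed

lemma measure_unit_ball_measure_ball:
  assumes "0 < R" "R \<le> 1"
  shows "measure (unit_ball_measure n) (Rn_ball n (Rn_zero n) R) = unit_ball_vol n * R ^ n"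
  using assms by (simp add: measure_def emeasure_unit_ball_measure_ball)

lemma L2_set_Rn_scale:
  assumes "0 \<le> a"
  shows "L2_set (Rn_scale n a x) {..<n} = a * L2_set x {..<n}"
  using assms by (auto simp: L2_set_right_distrib Rn_scale_def intro!: L2_set_cong)

text \<open>Past the ratio \<open>sqrt 2 - 1\<close> the minimum falls back on the smaller lens of
  that ratio, whose equator is a great sphere of the ball of radius \<open>R\<close>.\<close>

lemma measure_lens_ge:
  assumes n: "n \<ge> 1" and xi: "\<xi> \<in> Rn_sphere n" and r: "0 < r" "r < R" "R \<le> 1"
  defines "\<rho> \<equiv> min (r / R) (sqrt 2 - 1)"
  shows "measure (unit_ball_measure n) (Rn_ball n (Rn_scale n R \<xi>) (R + r))
    \<ge> unit_ball_vol n * (R * lens_radius \<rho>) ^ n / (sqrt pi * n)"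
proof -
  interpret finite_measure "unit_ball_measure n" by (rule finite_measure_unit_ball_measure)
  obtain m where m: "n = Suc m" using n by (cases n) auto
  have R: "0 < R" using r by simp
  have \<rho>: "0 < \<rho>" "\<rho> \<le> sqrt 2 - 1" "R * \<rho> \<le> r"
    using r by (auto simp: \<rho>_def min_def field_simps)
  have "ennreal (unit_ball_vol n * (R * lens_radius \<rho>) ^ n / (sqrt pi * n))
    \<le> emeasure (Rn_lborel n) (Rn_ball n (Rn_zero n) R \<inter> Rn_ball n (Rn_scale n R (Rn_pole m)) (R + R * \<rho>))"
    unfolding m by (rule emeasure_lens_pole_ge[OF \<rho>(1,2) R])
  also have "\<dots> = emeasure (Rn_lborel n) (Rn_ball n (Rn_zero n) R \<inter> Rn_ball n (Rn_scale n R \<xi>) (R + R * \<rho>))"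
    using R xi Rn_pole_sphere[of m] by (intro emeasure_lens_rotate) (simp add: L2_set_Rn_scale m Rn_sphere_def)
  also have "\<dots> \<le> emeasure (Rn_lborel n) (Rn_ball n (Rn_zero n) 1 \<inter> Rn_ball n (Rn_scale n R \<xi>) (R + r))"
    using r \<rho> by (intro emeasure_mono sets.Int Rn_ball_measurable Int_mono Rn_ball_mono) auto
  also have "\<dots> = emeasure (unit_ball_measure n) (Rn_ball n (Rn_scale n R \<xi>) (R + r))"
    by (simp add: emeasure_unit_ball_measure)
  finally show ?thesis by (simp add: emeasure_eq_measure)
qed

lemma measure_lens_le:
  assumes xi: "\<xi> \<in> Rn_sphere n" and r: "0 < r" "r \<le> sqrt 2 - 1"
  shows "measure (unit_ball_measure n) (Rn_ball n (Rn_scale n 1 \<xi>) (1 + r)) \<le> unit_ball_vol n * lens_radius r ^ n"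
proof -
  interpret finite_measure "unit_ball_measure n" by (rule finite_measure_unit_ball_measure)
  have "emeasure (unit_ball_measure n) (Rn_ball n (Rn_scale n 1 \<xi>) (1 + r))
    = emeasure (Rn_lborel n) (Rn_ball n (Rn_zero n) 1 \<inter> Rn_ball n (Rn_scale n 1 \<xi>) (1 + r))"
    by (simp add: emeasure_unit_ball_measure)
  also have "\<dots> \<le> emeasure (Rn_lborel n) (Rn_ball n (Rn_scale n (lens_height r) \<xi>) (lens_radius r))"
    by (intro emeasure_mono Rn_ball_measurable Rn_lens_subset_ball[OF r xi])
  also have "\<dots> = ennreal (unit_ball_vol n * lens_radius r ^ n)"
    by (rule emeasure_Rn_ball[OF lens_radius_pos[OF r]])
  finally show ?thesis
    using lens_radius_pos[OF r] by (simp add: emeasure_eq_measure)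
qed

lemma lens_radius_endpoint: "lens_radius (sqrt 2 - 1) = 1"
  by (simp add: lens_radius_eq lens_height_def)

lemma power_powr_swap: "0 < x \<Longrightarrow> (x ^ n) powr s = (x powr s) ^ n" for x s :: real
  by (simp add: powr_realpow[symmetric] powr_powr mult.commute)

lemma test_quot_unit_ball:
  assumes "0 < r" "r < R" "R \<le> 1"
  shows "test_quot n (unit_ball_measure n) p \<xi> R r =
    unit_ball_vol n * R ^ n / measure (unit_ball_measure n) (Rn_ball n (Rn_scale n R \<xi>) (R + r)) *
      ((r / R) powr ((p - 1) / p)) ^ n"
  using assms unfolding test_quot_def
  by (simp add: measure_unit_ball_measure_ball power_divide[symmetric] power_powr_swap)

lemma measure_lens_pos:
  assumes n: "n \<ge> 1" and xi: "\<xi> \<in> Rn_sphere n" and r: "0 < r" "r < R" "R \<le> 1"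
  shows "measure (unit_ball_measure n) (Rn_ball n (Rn_scale n R \<xi>) (R + r)) > 0"
proof -
  have "0 < lens_radius (min (r / R) (sqrt 2 - 1))" using r by (intro lens_radius_pos) auto
  then have "0 < unit_ball_vol n * (R * lens_radius (min (r / R) (sqrt 2 - 1))) ^ n / (sqrt pi * n)"
    using n r by simp
  also have "\<dots> \<le> measure (unit_ball_measure n) (Rn_ball n (Rn_scale n R \<xi>) (R + r))"
    by (rule measure_lens_ge[OF assms])
  finally show ?thesis .
qed

lemma test_quot_ge:
  assumes n: "n \<ge> 1" and xi: "\<xi> \<in> Rn_sphere n" and r: "0 < r" "r \<le> sqrt 2 - 1"
  shows "test_quot n (unit_ball_measure n) p \<xi> 1 r \<ge> (r powr ((p - 1) / p) / lens_radius r) ^ n"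
proof -
  let ?L = "measure (unit_ball_measure n) (Rn_ball n (Rn_scale n 1 \<xi>) (1 + r))"
  have "r < 1" using r sqrt2_less_2 by simp
  have "1 / lens_radius r ^ n = unit_ball_vol n / (unit_ball_vol n * lens_radius r ^ n)"
    using less_imp_neq[OF unit_ball_vol_pos[of n]] by simp
  also have "\<dots> \<le> unit_ball_vol n / ?L"
    using measure_lens_pos[OF n xi r(1) \<open>r < 1\<close>] measure_lens_le[OF xi r] lens_radius_pos[OF r]
    by (intro divide_left_mono) auto
  finally have "1 / lens_radius r ^ n * (r powr ((p - 1) / p)) ^ n \<le> unit_ball_vol n / ?L * (r powr ((p - 1) / p)) ^ n"
    by (rule mult_right_mono) simp
  then show ?thesis using r \<open>r < 1\<close> by (simp add: test_quot_unit_ball power_divide)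
qed

lemma test_quot_le:
  assumes n: "n \<ge> 1" and xi: "\<xi> \<in> Rn_sphere n" and r: "0 < r" "r < R" "R \<le> 1"
  defines "\<rho> \<equiv> min (r / R) (sqrt 2 - 1)"
  shows "test_quot n (unit_ball_measure n) p \<xi> R r \<le> sqrt pi * n * ((r / R) powr ((p - 1) / p) / lens_radius \<rho>) ^ n"
proof -
  let ?L = "measure (unit_ball_measure n) (Rn_ball n (Rn_scale n R \<xi>) (R + r))"
  have h: "0 < lens_radius \<rho>" using r by (intro lens_radius_pos) (auto simp: \<rho>_def)
  have "unit_ball_vol n * R ^ n / ?L \<le> unit_ball_vol n * R ^ n / (unit_ball_vol n * (R * lens_radius \<rho>) ^ n / (sqrt pi * n))"
    using measure_lens_ge[OF n xi r] measure_lens_pos[OF n xi r] h r n unfolding \<rho>_def[symmetric]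
    by (intro divide_left_mono mult_nonneg_nonneg mult_pos_pos divide_pos_pos) auto
  also have "\<dots> = sqrt pi * n / lens_radius \<rho> ^ n"
    using r h n by (simp add: power_mult_distrib less_imp_neq[THEN not_sym])
  finally have "unit_ball_vol n * R ^ n / ?L * ((r / R) powr ((p - 1) / p)) ^ n
    \<le> sqrt pi * n / lens_radius \<rho> ^ n * ((r / R) powr ((p - 1) / p)) ^ n"
    by (rule mult_right_mono) simp
  then show ?thesis using r by (simp add: test_quot_unit_ball power_divide)
qed

section \<open>The maximal function of the indicator of a small ball\<close>

lemma emeasure_moving_ball_le:
  assumes xi: "\<xi> \<in> Rn_sphere n" and x: "x \<in> Rn_ball n (Rn_zero n) 1" and "0 < r"
  shows "emeasure (unit_ball_measure n) (Rn_ball n x (L2_set x {..<n} + r))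
    \<le> emeasure (unit_ball_measure n) (Rn_ball n (Rn_scale n 1 \<xi>) (1 + r))"
proof -
  define a where "a = L2_set x {..<n}"
  have a: "0 \<le> a" "a < 1" using x by (simp_all add: a_def mem_Rn_ball_zero_iff)
  have norm_xi: "L2_set \<xi> {..<n} = 1" using xi by (simp add: Rn_sphere_def)
  have "emeasure (Rn_lborel n) (Rn_ball n (Rn_zero n) 1 \<inter> Rn_ball n x (a + r))
    = emeasure (Rn_lborel n) (Rn_ball n (Rn_zero n) 1 \<inter> Rn_ball n (Rn_scale n a \<xi>) (a + r))"
    using a by (intro emeasure_lens_rotate) (simp add: L2_set_Rn_scale norm_xi a_def)
  also have "\<dots> \<le> emeasure (Rn_lborel n) (Rn_ball n (Rn_zero n) 1 \<inter> Rn_ball n (Rn_scale n 1 \<xi>) (1 + r))"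
  \<comment> \<open>The centres are \<open>1 - a\<close> apart, exactly the difference of the radii,
    so the balls are nested.\<close>
  proof (intro emeasure_mono sets.Int Rn_ball_measurable Int_mono order_refl subsetI)
    fix y assume y: "y \<in> Rn_ball n (Rn_scale n a \<xi>) (a + r)"
    have "L2_set (\<lambda>i. y i - Rn_scale n 1 \<xi> i) {..<n}
      = L2_set (\<lambda>i. (y i - Rn_scale n a \<xi> i) + - (1 - a) * \<xi> i) {..<n}"
      by (intro L2_set_cong) (auto simp: Rn_scale_def algebra_simps)
    also have "\<dots> \<le> L2_set (\<lambda>i. y i - Rn_scale n a \<xi> i) {..<n} + L2_set (\<lambda>i. - (1 - a) * \<xi> i) {..<n}"
      by (rule L2_set_triangle_ineq)
    also have "L2_set (\<lambda>i. - (1 - a) * \<xi> i) {..<n} = L2_set (\<lambda>i. (1 - a) * \<xi> i) {..<n}"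
      unfolding L2_set_def by (simp add: power_mult_distrib) (simp add: power2_commute)
    also have "\<dots> = 1 - a" using a norm_xi by (simp add: L2_set_right_distrib[symmetric])
    finally show "y \<in> Rn_ball n (Rn_scale n 1 \<xi>) (1 + r)" using y by (simp add: Rn_ball_def)
  qed
  finally show ?thesis by (simp add: emeasure_unit_ball_measure a_def)
qed

lemma maximal_fun_indicator_ge:
  assumes n: "n \<ge> 1" and xi: "\<xi> \<in> Rn_sphere n" and x: "x \<in> Rn_ball n (Rn_zero n) 1" and r: "0 < r" "r < 1"
  shows "maximal_fun n (unit_ball_measure n) (indicator (Rn_ball n (Rn_zero n) r)) x
    \<ge> ennreal (unit_ball_vol n * r ^ n / measure (unit_ball_measure n) (Rn_ball n (Rn_scale n 1 \<xi>) (1 + r)))"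
proof -
  interpret finite_measure "unit_ball_measure n" by (rule finite_measure_unit_ball_measure)
  let ?\<mu> = "unit_ball_measure n" and ?B = "Rn_ball n (Rn_zero n) r"
  \<comment> \<open>The radius is chosen so that the ball about \<open>x\<close> swallows all of
    \<open>?B\<close> and the average has the full mass of \<open>?B\<close> as numerator.\<close>
  define D where "D = Rn_ball n x (L2_set x {..<n} + r)"
  have sub: "?B \<subseteq> D"
  proof
    fix y assume y: "y \<in> ?B"
    have "L2_set (\<lambda>i. y i + - x i) {..<n} \<le> L2_set y {..<n} + L2_set (\<lambda>i. - x i) {..<n}"
      by (rule L2_set_triangle_ineq)
    then have "L2_set (\<lambda>i. y i - x i) {..<n} \<le> L2_set y {..<n} + L2_set x {..<n}"
      by (simp add: L2_set_def)
    then show "y \<in> D" using y unfolding D_def mem_Rn_ball_zero_iff by (simp add: Rn_ball_def)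
  qed
  have D [measurable]: "D \<in> sets ?\<mu>" by (simp add: D_def sets_unit_ball_measure)
  have B [measurable]: "?B \<in> sets ?\<mu>" by (simp add: sets_unit_ball_measure)
  have "(\<integral>\<^sup>+y\<in>D. ennreal \<bar>indicator ?B y\<bar> \<partial>?\<mu>) = (\<integral>\<^sup>+y. indicator ?B y \<partial>?\<mu>)"
    using sub by (intro nn_integral_cong) (auto simp: indicator_def)
  also have "\<dots> = ennreal (unit_ball_vol n * r ^ n)"
    using r by (simp add: emeasure_unit_ball_measure_ball)
  finally have num: "(\<integral>\<^sup>+y\<in>D. ennreal \<bar>indicator ?B y\<bar> \<partial>?\<mu>) = ennreal (unit_ball_vol n * r ^ n)" .
  have "unit_ball_vol n * r ^ n \<le> measure ?\<mu> D"
    using finite_measure_mono[OF sub D] r by (simp add: measure_unit_ball_measure_ball)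
  moreover have "0 < unit_ball_vol n * r ^ n" using r by simp
  ultimately have D_pos: "0 < measure ?\<mu> D" by linarith
  have "measure ?\<mu> D \<le> measure ?\<mu> (Rn_ball n (Rn_scale n 1 \<xi>) (1 + r))"
    using emeasure_moving_ball_le[OF xi x r(1)] by (simp add: D_def emeasure_eq_measure)
  then have "ennreal (unit_ball_vol n * r ^ n / measure ?\<mu> (Rn_ball n (Rn_scale n 1 \<xi>) (1 + r)))
    \<le> ennreal (unit_ball_vol n * r ^ n / measure ?\<mu> D)"
    using D_pos r by (intro ennreal_leI divide_left_mono) auto
  also have "\<dots> = (\<integral>\<^sup>+y\<in>D. ennreal \<bar>indicator ?B y\<bar> \<partial>?\<mu>) / emeasure ?\<mu> D"
    unfolding num emeasure_eq_measure using D_pos r by (subst divide_ennreal) auto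
  also have "\<dots> \<le> maximal_fun n ?\<mu> (indicator ?B) x"
    unfolding maximal_fun_def D_def
    by (rule SUP_upper) (use r L2_set_nonneg[of x "{..<n}"] in \<open>auto intro: add_nonneg_pos\<close>)
  finally show ?thesis .
qed

lemma ennreal_powr_ennreal [simp]: "0 \<le> x \<Longrightarrow> ennreal_powr (ennreal x) a = ennreal (x powr a)"
  by (simp add: ennreal_powr_def)

lemma ennreal_powr_mono:
  assumes "x \<le> y" "0 \<le> a"
  shows "ennreal_powr x a \<le> ennreal_powr y a"
  using assms unfolding ennreal_powr_def
  by (auto simp: top_unique less_top intro!: ennreal_leI powr_mono2 enn2real_mono)

text \<open>Let \<open>V\<close>, \<open>a\<close> and \<open>L\<close> be the masses of the unit
  ball, the small ball and the lens at \<xi>. The maximal function is at least \<open>a / L\<close>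
  on mass \<open>V\<close>, and the indicator has norm \<open>a powr (1 / p)\<close>. So
  \<open>C\<close> is at least \<open>a / L * (V / a) powr (1 / p)\<close>, which rearranges to the
  test quotient.\<close>

lemma test_quot_le_best_const:
  assumes p: "1 \<le> p" and n: "n \<ge> 1" and xi: "\<xi> \<in> Rn_sphere n" and r: "0 < r" "r < 1"
  shows "ennreal (test_quot n (unit_ball_measure n) p \<xi> 1 r) \<le> best_const n (unit_ball_measure n) p"
  unfolding best_const_def
proof (rule Inf_greatest, clarify)
  fix C :: real assume C: "0 \<le> C"
    and bound: "\<forall>g\<in>Lp_space (unit_ball_measure n) p. Lp_norm (unit_ball_measure n) p (maximal_fun n (unit_ball_measure n) g)
      \<le> ennreal C * Lp_norm (unit_ball_measure n) p (\<lambda>x. ennreal \<bar>g x\<bar>)"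
  let ?\<mu> = "unit_ball_measure n" and ?B = "Rn_ball n (Rn_zero n) r"
  define V where "V = unit_ball_vol n"
  define L where "L = measure ?\<mu> (Rn_ball n (Rn_scale n 1 \<xi>) (1 + r))"
  define a where "a = V * r ^ n"
  have V: "V > 0" by (simp add: V_def)
  have L: "L > 0" unfolding L_def by (rule measure_lens_pos[OF n xi r]) simp
  have a: "a > 0" using V r by (simp add: a_def)
  have B [measurable]: "?B \<in> sets ?\<mu>" by (simp add: sets_unit_ball_measure)
  have "(\<integral>\<^sup>+x. ennreal_powr (ennreal \<bar>indicator ?B x\<bar>) p \<partial>?\<mu>) = (\<integral>\<^sup>+x. indicator ?B x \<partial>?\<mu>)"
    using p by (intro nn_integral_cong) (auto simp: indicator_def)
  also have "\<dots> = ennreal a" using r by (simp add: emeasure_unit_ball_measure_ball a_def V_def)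
  finally have norm_g: "Lp_norm ?\<mu> p (\<lambda>x. ennreal \<bar>indicator ?B x\<bar>) = ennreal (a powr (1 / p))"
    using a by (simp add: Lp_norm_def)
  have "indicator ?B \<in> Lp_space ?\<mu> p"
    using norm_g by (simp add: Lp_space_def)
  with bound norm_g have le: "Lp_norm ?\<mu> p (maximal_fun n ?\<mu> (indicator ?B)) \<le> ennreal (C * a powr (1 / p))"
    using C by (auto simp: ennreal_mult')
  have "ennreal ((a / L) powr p * V) = (\<integral>\<^sup>+x. ennreal ((a / L) powr p) * indicator (Rn_ball n (Rn_zero n) 1) x \<partial>?\<mu>)"
    using V by (subst nn_integral_cmult_indicator)
      (auto simp: sets_unit_ball_measure emeasure_unit_ball_measure_ball ennreal_mult' V_def)
  also have "\<dots> \<le> (\<integral>\<^sup>+x. ennreal_powr (maximal_fun n ?\<mu> (indicator ?B) x) p \<partial>?\<mu>)"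
  proof (rule nn_integral_mono)
    fix x
    show "ennreal ((a / L) powr p) * indicator (Rn_ball n (Rn_zero n) 1) x \<le> ennreal_powr (maximal_fun n ?\<mu> (indicator ?B) x) p"
    proof (cases "x \<in> Rn_ball n (Rn_zero n) 1")
      case True
      have "ennreal (a / L) \<le> maximal_fun n ?\<mu> (indicator ?B) x"
        using maximal_fun_indicator_ge[OF n xi True r] by (simp add: a_def L_def V_def)
      from ennreal_powr_mono[OF this, of p] show ?thesis using True a L p by simp
    qed simp
  qed
  finally have "ennreal_powr (ennreal ((a / L) powr p * V)) (1 / p) \<le> Lp_norm ?\<mu> p (maximal_fun n ?\<mu> (indicator ?B))"
    unfolding Lp_norm_def using p by (intro ennreal_powr_mono) auto
  then have "ennreal (((a / L) powr p * V) powr (1 / p)) \<le> ennreal (C * a powr (1 / p))"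
    using le V by (simp add: order_trans)
  then have "((a / L) powr p * V) powr (1 / p) \<le> C * a powr (1 / p)"
    using C by simp
  then have "a / L * V powr (1 / p) \<le> C * a powr (1 / p)"
    using a L V p by (simp add: powr_mult powr_powr)
  then have "a / L * V powr (1 / p) / a powr (1 / p) \<le> C"
    using a by (subst pos_divide_le_eq) simp_all
  also have "a / L * V powr (1 / p) / a powr (1 / p) = V / L * (a / V) powr (1 - 1 / p)"
    using a V L by (simp add: powr_diff powr_divide field_simps)
  also have "\<dots> = test_quot n ?\<mu> p \<xi> 1 r"
    using r p V unfolding test_quot_def
    by (simp add: measure_unit_ball_measure_ball diff_divide_distrib V_def a_def L_def)
  finally show "ennreal (test_quot n ?\<mu> p \<xi> 1 r) \<le> ennreal C" by (rule ennreal_leI)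
qed

section \<open>The threshold and the two regimes\<close>

theorem proposition4p1:
  shows "\<exists>p0::real. p0 > 1 \<and> \<bar>p0 - 1.03946\<bar> < 0.000005 \<and>
    (\<forall>p::real. 1 \<le> p \<and> p < p0 \<longrightarrow>
       (\<exists>\<alpha>::real. \<alpha> > 1 \<and>
          (\<forall>n::nat. n \<ge> 1 \<longrightarrow>
             (\<exists>r::real. 0 < r \<and> r < sqrt 2 - 1 \<and>
                (\<forall>\<xi>\<in>Rn_sphere n.
                   best_const n (unit_ball_measure n) p
                     \<ge> ennreal (test_quot n (unit_ball_measure n) p \<xi> 1 r) \<and>
                   test_quot n (unit_ball_measure n) p \<xi> 1 r \<ge> \<alpha> ^ n))))) \<and>
    (\<forall>p::real. p > p0 \<longrightarrow>
       (\<forall>r R::real. 0 < r \<and> r < R \<and> R \<le> 1 \<longrightarrow>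
          (\<exists>\<alpha>::real. \<alpha> < 1 \<and>
             (\<forall>n::nat. n \<ge> 1 \<longrightarrow>
                (\<forall>\<xi>\<in>Rn_sphere n.
                   test_quot n (unit_ball_measure n) p \<xi> R r \<le> sqrt pi * real n * \<alpha> ^ n)))))"
proof -
  define s0 where "s0 = (SUP r\<in>{0<..<sqrt 2 - 1}. crit_exponent r)"
  have bdd: "bdd_above (crit_exponent ` {0<..<sqrt 2 - 1})"
    using crit_exponent_upper by (intro bdd_aboveI2[where M = "0.0379666"]) auto
  have sqrt2: "sqrt 2 > (1.4::real)" by (rule real_less_rsqrt) (simp add: power2_eq_square)
  then have mem: "0.0673 \<in> {0<..<sqrt 2 - 1}" by simp
  have s0_ge: "crit_exponent r \<le> s0" if "0 < r" "r < sqrt 2 - 1" for r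
    unfolding s0_def using that by (intro cSUP_upper[OF _ bdd]) auto
  have "0.03796 \<le> s0" using s0_ge[of "0.0673"] mem crit_exponent_lower by auto
  moreover have "s0 \<le> 0.0379666"
    unfolding s0_def using crit_exponent_upper mem by (intro cSUP_least) auto
  ultimately have s0: "0.03796 \<le> s0" "s0 \<le> 0.0379666" .
  define p0 where "p0 = 1 / (1 - s0)"
  have p0_bounds: "1 / (1 - 0.03796) \<le> p0" "p0 \<le> 1 / (1 - 0.0379666)"
    unfolding p0_def by (rule divide_left_mono; use s0 in simp)+
  have less_p0_iff: "p < p0 \<longleftrightarrow> (p - 1) / p < s0" and greater_p0_iff: "p > p0 \<longleftrightarrow> (p - 1) / p > s0"
    if "p \<ge> 1" for p
    using that s0 by (auto simp: p0_def field_simps)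
  have lens_pos: "lens_radius r > 0" "ln r < 0" if "0 < r" "r < sqrt 2 - 1" for r
    using that lens_radius_pos[of r] sqrt2_less_2 by auto
  show ?thesis
  proof (rule exI[of _ p0], intro conjI allI impI)
    show "p0 > 1" using p0_bounds by simp
    show "\<bar>p0 - 1.03946\<bar> < 0.000005"
      by (rule abs_less_iff[THEN iffD2], rule conjI; use p0_bounds in simp)
  next
    fix p :: real assume p: "1 \<le> p \<and> p < p0"
    define s where "s = (p - 1) / p"
    have "s < s0" using p less_p0_iff[of p] by (simp add: s_def)
    moreover have "{0<..<sqrt 2 - 1} \<noteq> {}" using mem by blast
    \<comment> \<open>Below the supremum some \<open>r\<close> beats \<open>s\<close>, whether or
      not the supremum is attained. The choice precedes \<open>n\<close>, so one \<open>r\<close>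
      and one \<alpha> serve all dimensions.\<close>
    ultimately obtain r where r: "0 < r" "r < sqrt 2 - 1" "s < crit_exponent r"
      unfolding s0_def using less_cSUP_iff[OF _ bdd] by auto
    have "r < 1" using r sqrt2_less_2 by simp
    have "ln (lens_radius r) < s * ln r"
      using r lens_pos[OF r(1,2)] by (simp add: crit_exponent_def neg_less_divide_eq)
    then have "exp (ln (lens_radius r)) < exp (s * ln r)" by (simp only: exp_less_cancel_iff)
    then have "lens_radius r < r powr s"
      using lens_pos[OF r(1,2)] r by (simp add: powr_def)
    then have "1 < r powr s / lens_radius r" using lens_pos[OF r(1,2)] by simp
    moreover have "ennreal (test_quot n (unit_ball_measure n) p \<xi> 1 r) \<le> best_const n (unit_ball_measure n) p
        \<and> (r powr s / lens_radius r) ^ n \<le> test_quot n (unit_ball_measure n) p \<xi> 1 r"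
      if "n \<ge> 1" "\<xi> \<in> Rn_sphere n" for n \<xi>
      using test_quot_le_best_const[of p n \<xi> r] test_quot_ge[of n \<xi> r p] that p r \<open>r < 1\<close> by (auto simp: s_def)
    ultimately show "\<exists>\<alpha>>1. \<forall>n\<ge>1. \<exists>r>0. r < sqrt 2 - 1 \<and> (\<forall>\<xi>\<in>Rn_sphere n.
        ennreal (test_quot n (unit_ball_measure n) p \<xi> 1 r) \<le> best_const n (unit_ball_measure n) p \<and>
        \<alpha> ^ n \<le> test_quot n (unit_ball_measure n) p \<xi> 1 r)"
      using r by blast
  next
    fix p r R :: real assume p: "p0 < p" and rR: "0 < r \<and> r < R \<and> R \<le> 1"
    define s where "s = (p - 1) / p"
    have "p > 1" using p p0_bounds by simp
    have s: "s > s0" using p greater_p0_iff[of p] \<open>p > 1\<close> by (simp add: s_def)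
    define \<rho> where "\<rho> = min (r / R) (sqrt 2 - 1)"
    have "(r / R) powr s / lens_radius \<rho> < 1"
    proof (cases "r / R < sqrt 2 - 1")
      case True
      have "crit_exponent (r / R) < s" using s0_ge[of "r / R"] True rR s by simp
      moreover have pos: "lens_radius (r / R) > 0" "ln (r / R) < 0" using lens_pos[of "r / R"] True rR by auto
      ultimately have "s * ln (r / R) < ln (lens_radius (r / R))"
        by (simp add: crit_exponent_def neg_divide_less_eq)
      then have "exp (s * ln (r / R)) < exp (ln (lens_radius (r / R)))" by (simp only: exp_less_cancel_iff)
      then have "(r / R) powr s < lens_radius (r / R)"
        using pos rR by (simp add: powr_def)
      then show ?thesis using True pos by (simp add: \<rho>_def)
    next
      \<comment> \<open>Here the lens radius is 1, and \<open>s > 0\<close> alone makes the base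
        smaller than 1.\<close>
      case False
      then have "\<rho> = sqrt 2 - 1" by (simp add: \<rho>_def)
      moreover have "(r / R) powr s < 1 powr s" using rR s s0 by (intro powr_less_mono2) auto
      ultimately show ?thesis by (simp add: lens_radius_endpoint)
    qed
    moreover have "test_quot n (unit_ball_measure n) p \<xi> R r \<le> sqrt pi * real n * ((r / R) powr s / lens_radius \<rho>) ^ n"
      if "n \<ge> 1" "\<xi> \<in> Rn_sphere n" for n \<xi>
      using test_quot_le[of n \<xi> r R p] that rR by (simp add: s_def \<rho>_def)
    ultimately show "\<exists>\<alpha><1. \<forall>n\<ge>1. \<forall>\<xi>\<in>Rn_sphere n.
        test_quot n (unit_ball_measure n) p \<xi> R r \<le> sqrt pi * real n * \<alpha> ^ n"
      by blast
  qed
qed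

end
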